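(* Assume $F(b^*_{v,F})>0$ and $F$ is unknown to the bidder. For any $\gamma>1$, the regret of O-UCBid1 satisfies $$R_T^{v,F}\ \le\ \frac{4\sqrt2}{F(b^*_{v,F})}\sqrt{\gamma\log T}\,(\sqrt T+1)+O(1).$$
   Context: Model: at rounds $t=1,\dots,T$ a bidder submits $B_t\in[0,1]$. $(V_t)$ i.i.d. in $[0,1]$ with mean $v$; $(M_t)$ i.i.d. in $[0,1]$ with CDF $F$, independent of $(V_t)$. If $M_t\le B_t$ the bidder wins, pays $B_t$, receives and observes $V_t$; otherwise she does not observe $V_t$. $M_t$ is observed at the end of every round. $U_{v,F}(b)=(v-b)F(b)$, $b^*_{v,F}=\max\{\operatorname{argmax}_{b\in[0,1]}U_{v,F}(b)\}$, $R_T^{v,F}=T\max_bU_{v,F}(b)-\sum_{t=1}^T\mathbb E[U_{v,F}(B_t)]$. Notation: $N_t=\sum_{s=1}^{t-1}\mathbf 1\{M_s\le B_s\}$, $\hat V_t=\frac1{N_t}\sum_{s=1}^{t-1}V_s\mathbf 1\{M_s\le B_s\}$, $\epsilon_t=\sqrt{\gamma\log(t-1)/(2N_t)}$, $\hat F_t(b)=\frac1{t-1}\sum_{s=1}^{t-1}\mathbf 1\{M_s<b\}$, $\hat U_t(b)=(\hat V_t-b)\hat F_t(b)$. Algorithm O-UCBid1: $B_1=1$ and for $t\ge2$, $B_t=\max\{b\in[0,\hat V_t+\epsilon_t]:\ \hat U_t(b)\ge\max_{b'\in[0,1]}\hat U_t(b')-2\epsilon_t\}$.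
   Formalization: Since max of Û_t need not be attained, it is read as a supremum; at t=2 (ε_2=0) the feasible set may then be empty and the bid is taken to be min(1, V̂_t+ε_t); bids are restricted to [0, min(1, V̂_t+ε_t)] so that B_t∈[0,1]; b* is the supremum of the argmax set. *)

theory Defs
  imports "HOL-Probability.Probability"
begin

definition util :: "real \<Rightarrow> (real \<Rightarrow> real) \<Rightarrow> real \<Rightarrow> real" where
  "util v F b = (v - b) * F b"

definition bstar :: "real \<Rightarrow> (real \<Rightarrow> real) \<Rightarrow> real" where
  "bstar v F = Sup {b \<in> {0..1}. \<forall>b'\<in>{0..1}. util v F b' \<le> util v F b}"

text \<open>Next bid of O-UCBid1, computed from the bids bs = [B_1,...,B_(t-1)] already placed
  (so t = length bs + 1) and the realised sequences vs (values) and ms (competing bids),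
  both indexed by rounds s = 1,2,...\<close>
definition oucb_next :: "real \<Rightarrow> (nat \<Rightarrow> real) \<Rightarrow> (nat \<Rightarrow> real) \<Rightarrow> real list \<Rightarrow> real" where
  "oucb_next \<gamma> vs ms bs =
     (let t = length bs + 1 in
      if t = 1 then 1 else
      let win = (\<lambda>s. ms s \<le> bs ! (s - 1));
          N = card {s \<in> {1..<t}. win s};
          hV = (\<Sum>s\<in>{1..<t}. if win s then vs s else 0) / real N;
          eps = sqrt (\<gamma> * ln (real (t - 1)) / (2 * real N));
          hF = (\<lambda>b. real (card {s \<in> {1..<t}. ms s < b}) / real (t - 1));
          hU = (\<lambda>b. (hV - b) * hF b);
          S = {b \<in> {0..min 1 (hV + eps)}. hU b \<ge> (SUP b'\<in>{0..1}. hU b') - 2 * eps}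
      in if S = {} then min 1 (hV + eps) else Sup S)"

fun oucb_bids :: "real \<Rightarrow> (nat \<Rightarrow> real) \<Rightarrow> (nat \<Rightarrow> real) \<Rightarrow> nat \<Rightarrow> real list" where
  "oucb_bids \<gamma> vs ms 0 = []"
| "oucb_bids \<gamma> vs ms (Suc n) =
     oucb_bids \<gamma> vs ms n @ [oucb_next \<gamma> vs ms (oucb_bids \<gamma> vs ms n)]"

definition oucb_bid :: "real \<Rightarrow> (nat \<Rightarrow> real) \<Rightarrow> (nat \<Rightarrow> real) \<Rightarrow> nat \<Rightarrow> real" where
  "oucb_bid \<gamma> vs ms t = oucb_bids \<gamma> vs ms t ! (t - 1)"

definition regret :: "'a measure \<Rightarrow> real \<Rightarrow> (real \<Rightarrow> real) \<Rightarrow> (nat \<Rightarrow> 'a \<Rightarrow> real) \<Rightarrow> nat \<Rightarrow> real" where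
  "regret P v F B T =
     real T * (SUP b\<in>{0..1}. util v F b)
     - (\<Sum>t=1..T. prob_space.expectation P (\<lambda>\<omega>. util v F (B t \<omega>)))"

end

theory Submission
  imports Defs "HOL-Real_Asymp.Real_Asymp"
begin

text \<open>
  Outside an event of summable probability, the regret of round \<open>n + 1\<close> is at most
  \<open>4 * \<epsilon> * F B / F (bstar v F)\<close>, where \<open>\<epsilon>\<close> is the confidence radius and \<open>B\<close> the bid. Given the past, \<open>F B\<close>
  is the probability of winning, so in expectation \<open>\<epsilon> * F B\<close> may be replaced by \<open>\<epsilon>\<close> times the indicator of
  a win. The number of wins below the square root in \<open>\<epsilon>\<close> increases at each win, whence the sum over
  all rounds is at most \<open>sqrt (\<gamma> * ln T / 2) * 2 * sqrt T\<close>.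

  The factor \<open>F B / F (bstar v F)\<close> is at least one because the bid exceeds \<open>bstar v F\<close> on the good event.
  Overestimating the utility of a smaller bid \<open>b\<close> relative to \<open>bstar v F\<close> by \<open>2 * \<epsilon>\<close> involves an error
  \<open>\<epsilon> * q\<close> from the value estimate, \<open>q\<close> being the mass of the competing bids between \<open>b\<close> and
  \<open>bstar v F\<close>, and a fluctuation of variance about \<open>q * (1 - q)\<close>. A second-order exponential
  bound gives probability \<open>n powr (- 2 * \<gamma>)\<close> for one \<open>b\<close>, small enough for a union bound over
  \<open>n\<close> equidistant bids, so that no sharp uniform (Dvoretzky-Kiefer-Wolfowitz) inequality is needed. The
  value estimate, based on a random number of observations, is controlled by an exponential
  supermartingale and geometric peeling.
\<close>

section \<open>The bidding rule\<close>

text \<open>The obstacle is that the rule tolerates a loss of exactly \<open>2 * \<epsilon>\<close>,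
  which leaves no room for separate worst-case errors of the value estimate and of the empirical
  distribution. The latter is observed in every round, hence fluctuates on the smaller scale
  \<open>\<delta> = width n\<close>, while \<open>\<epsilon>\<close> depends on the number of wins.
  The value error is therefore split into \<open>\<delta>\<close> and
  \<open>\<epsilon> - \<delta>\<close>. The second part costs at most itself; the first goes into
  the same exponential moment as the fluctuation, and the two together have to stay below
  \<open>2 * \<delta>\<close>. With exponential parameter \<open>l * \<delta>\<close>, the exponent
  divided by \<open>n * \<delta> ^ 2\<close> is to leading order at worst
  \<open>(l / 2 + 1) ^ 2 / 2 - 2 * l\<close>, which is least at \<open>l = 6\<close>, with value
  \<open>-4\<close>; and \<open>n * \<delta> ^ 2 = \<gamma> * ln n / 2\<close>.

  Atoms of the competing bids are the second obstacle: the rule counts bids strictly below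
  \<open>b\<close>, whereas \<open>F\<close> counts ties as wins. The empirical utility is thus only
  left-continuous, \<open>bstar\<close> has to be approached from the right, and quantiles exist
  only in a generalised sense.\<close>

definition win_set :: "real \<Rightarrow> (nat \<Rightarrow> real) \<Rightarrow> (nat \<Rightarrow> real) \<Rightarrow> nat \<Rightarrow> nat set" where
  "win_set \<gamma> vs ms n = {s \<in> {1..n}. ms s \<le> oucb_bid \<gamma> vs ms s}"

text \<open>The index counts completed rounds, here and below: at \<open>n\<close> this is the
  number of wins available to the bid of round \<open>n + 1\<close>.\<close>

definition win_count :: "real \<Rightarrow> (nat \<Rightarrow> real) \<Rightarrow> (nat \<Rightarrow> real) \<Rightarrow> nat \<Rightarrow> nat" where
  "win_count \<gamma> vs ms n = card (win_set \<gamma> vs ms n)"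

definition value_mean :: "real \<Rightarrow> (nat \<Rightarrow> real) \<Rightarrow> (nat \<Rightarrow> real) \<Rightarrow> nat \<Rightarrow> real" where
  "value_mean \<gamma> vs ms n = (\<Sum>s\<in>win_set \<gamma> vs ms n. vs s) / real (win_count \<gamma> vs ms n)"

definition radius :: "real \<Rightarrow> (nat \<Rightarrow> real) \<Rightarrow> (nat \<Rightarrow> real) \<Rightarrow> nat \<Rightarrow> real" where
  "radius \<gamma> vs ms n = sqrt (\<gamma> * ln (real n) / (2 * real (win_count \<gamma> vs ms n)))"

text \<open>The bidder never computes this non-strict version. It is the right limit of
  \<open>ecdf_less\<close> and the natural estimate of \<open>F\<close>, atoms included.\<close>

definition ecdf :: "(nat \<Rightarrow> real) \<Rightarrow> nat \<Rightarrow> real \<Rightarrow> real" where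
  "ecdf ms n b = real (card {s \<in> {1..n}. ms s \<le> b}) / real n"

definition ecdf_less :: "(nat \<Rightarrow> real) \<Rightarrow> nat \<Rightarrow> real \<Rightarrow> real" where
  "ecdf_less ms n b = real (card {s \<in> {1..n}. ms s < b}) / real n"

definition candidates :: "real \<Rightarrow> real \<Rightarrow> (real \<Rightarrow> real) \<Rightarrow> real set" where
  "candidates a e G =
     {b \<in> {0..min 1 (a + e)}. (SUP b'\<in>{0..1}. (a - b') * G b') - 2 * e \<le> (a - b) * G b}"

definition upper_bid :: "real \<Rightarrow> real \<Rightarrow> (real \<Rightarrow> real) \<Rightarrow> real" where
  "upper_bid a e G = (if candidates a e G = {} then min 1 (a + e) else Sup (candidates a e G))"

lemma length_oucb_bids [simp]: "length (oucb_bids \<gamma> vs ms n) = n"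
  by (induction n) auto

lemma oucb_bids_nth:
  assumes "i < n" shows "oucb_bids \<gamma> vs ms n ! i = oucb_bid \<gamma> vs ms (Suc i)"
  using assms
proof (induction n)
  case (Suc n)
  show ?case
  proof (cases "i = n")
    case True
    then show ?thesis by (simp add: oucb_bid_def)
  next
    case False
    then show ?thesis using Suc by (simp add: nth_append)
  qed
qed simp

lemma oucb_bid_1 [simp]: "oucb_bid \<gamma> vs ms (Suc 0) = 1"
  by (simp add: oucb_bid_def oucb_next_def)

lemma oucb_bid_Suc:
  assumes "n \<ge> 1"
  shows "oucb_bid \<gamma> vs ms (Suc n) =
    upper_bid (value_mean \<gamma> vs ms n) (radius \<gamma> vs ms n) (ecdf_less ms n)"
proof -
  let ?bs = "oucb_bids \<gamma> vs ms n"
  have nth: "?bs ! (s - 1) = oucb_bid \<gamma> vs ms s" if "s \<in> {1..<Suc n}" for s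
    using that by (subst oucb_bids_nth) auto
  have set_eq: "{s \<in> {1..<Suc n}. ms s \<le> ?bs ! (s - 1)} = win_set \<gamma> vs ms n"
    unfolding win_set_def using nth by auto
  have "(\<Sum>s\<in>{1..<Suc n}. if ms s \<le> ?bs ! (s - 1) then vs s else 0)
      = (\<Sum>s\<in>{s \<in> {1..<Suc n}. ms s \<le> ?bs ! (s - 1)}. vs s)"
    by (rule sum.inter_filter[symmetric]) simp
  then have sum_eq: "(\<Sum>s\<in>{1..<Suc n}. if ms s \<le> ?bs ! (s - 1) then vs s else 0)
      = (\<Sum>s\<in>win_set \<gamma> vs ms n. vs s)"
    by (simp only: set_eq)
  have less_eq: "{s \<in> {1..<Suc n}. ms s < b} = {s \<in> {1..n}. ms s < b}" for b
    by auto
  have not_one: "(Suc n = 1) = False" using assms by simp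
  have "oucb_bid \<gamma> vs ms (Suc n) = oucb_next \<gamma> vs ms ?bs"
    by (simp add: oucb_bid_def nth_append)
  also have "\<dots> = upper_bid (value_mean \<gamma> vs ms n) (radius \<gamma> vs ms n) (ecdf_less ms n)"
    using assms
    unfolding oucb_next_def Let_def length_oucb_bids Suc_eq_plus1[symmetric] set_eq sum_eq less_eq
      upper_bid_def candidates_def value_mean_def radius_def win_count_def ecdf_less_def
    by (simp only: not_one diff_Suc_1 if_False)
  finally show ?thesis .
qed

section \<open>Wins and their dependence on the history\<close>

lemma finite_win_set [simp]: "finite (win_set \<gamma> vs ms n)"
  by (simp add: win_set_def)

lemma win_set_0 [simp]: "win_set \<gamma> vs ms 0 = {}"
  by (simp add: win_set_def)

lemma win_set_Suc:
  "win_set \<gamma> vs ms (Suc n) = (if ms (Suc n) \<le> oucb_bid \<gamma> vs ms (Suc n)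
     then insert (Suc n) (win_set \<gamma> vs ms n) else win_set \<gamma> vs ms n)"
  by (auto simp: win_set_def le_Suc_eq)

lemma Suc_notin_win_set [simp]: "Suc n \<notin> win_set \<gamma> vs ms n"
  by (simp add: win_set_def)

lemma win_count_Suc:
  "win_count \<gamma> vs ms (Suc n) = win_count \<gamma> vs ms n +
     (if ms (Suc n) \<le> oucb_bid \<gamma> vs ms (Suc n) then 1 else 0)"
  by (simp add: win_count_def win_set_Suc)

lemma win_count_le: "win_count \<gamma> vs ms n \<le> n"
proof -
  have "card (win_set \<gamma> vs ms n) \<le> card {1..n}"
    by (intro card_mono) (auto simp: win_set_def)
  then show ?thesis by (simp add: win_count_def)
qed

text \<open>The opening bid 1 beats every competing bid in the unit interval, so from the second
  round on the divisions by the number of wins are genuine.\<close>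

lemma win_count_pos:
  assumes "n \<ge> 1" "ms 1 \<le> 1" shows "win_count \<gamma> vs ms n \<ge> 1"
proof -
  have "1 \<in> win_set \<gamma> vs ms n"
    using assms by (simp add: win_set_def)
  then show ?thesis
    unfolding win_count_def by (metis One_nat_def Suc_leI card_gt_0_iff empty_iff finite_win_set)
qed

text \<open>Predictability of the bids. It is what later allows the coordinates of the current round
  to be removed from the sample and integrated out separately.\<close>

lemma oucb_bid_cong:
  assumes "\<And>s. s \<in> {1..<t} \<Longrightarrow> vs s = vs' s" "\<And>s. s \<in> {1..<t} \<Longrightarrow> ms s = ms' s"
  shows "oucb_bid \<gamma> vs ms t = oucb_bid \<gamma> vs' ms' t"
  using assms
proof (induction t rule: less_induct)
  case (less t)
  show ?case
  proof (cases "t \<le> 1")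
    case True
    then consider "t = 0" | "t = 1" by linarith
    \<comment> \<open>There is no round 0: there \<open>oucb_bid\<close> unfolds to
      \<open>[] ! 0\<close>, the same unspecified constant on both sides.\<close>
    then show ?thesis by cases (auto simp: oucb_bid_def oucb_next_def)
  next
    case False
    then obtain n where n: "t = Suc n" "n \<ge> 1" by (cases t) auto
    have bid: "oucb_bid \<gamma> vs ms s = oucb_bid \<gamma> vs' ms' s" if "s \<in> {1..n}" for s
      using that n less by (intro less.IH) auto
    have win: "win_set \<gamma> vs ms n = win_set \<gamma> vs' ms' n"
      unfolding win_set_def using bid less.prems n by auto
    have "{s \<in> {1..n}. ms s < b} = {s \<in> {1..n}. ms' s < b}" for b
      using less.prems n by auto
    then have "ecdf_less ms n = ecdf_less ms' n"
      by (simp add: ecdf_less_def fun_eq_iff)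
    moreover have "(\<Sum>s\<in>win_set \<gamma> vs ms n. vs s) = (\<Sum>s\<in>win_set \<gamma> vs' ms' n. vs' s)"
      unfolding win using less.prems n by (intro sum.cong) (auto simp: win_set_def)
    ultimately show ?thesis
      using n win by (simp add: oucb_bid_Suc value_mean_def radius_def win_count_def)
  qed
qed

lemma win_set_cong:
  assumes "\<And>s. s \<in> {1..n} \<Longrightarrow> vs s = vs' s" "\<And>s. s \<in> {1..n} \<Longrightarrow> ms s = ms' s"
  shows "win_set \<gamma> vs ms n = win_set \<gamma> vs' ms' n"
proof -
  have "oucb_bid \<gamma> vs ms s = oucb_bid \<gamma> vs' ms' s" if "s \<in> {1..n}" for s
    using that assms by (intro oucb_bid_cong) auto
  then show ?thesis
    using assms by (auto simp: win_set_def)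
qed

section \<open>Elementary bounds for the next bid\<close>

lemma upper_bid_le: "upper_bid a e G \<le> min 1 (a + e)"
proof (cases "candidates a e G = {}")
  case False
  then show ?thesis
    unfolding upper_bid_def by (auto intro!: cSup_least simp: candidates_def)
qed (simp add: upper_bid_def)

lemma bdd_above_candidates: "bdd_above (candidates a e G)"
  by (rule bdd_aboveI[of _ 1]) (auto simp: candidates_def)

lemma upper_bid_ge:
  assumes "b \<in> candidates a e G" shows "b \<le> upper_bid a e G"
  using assms by (auto simp: upper_bid_def intro!: cSup_upper bdd_above_candidates)

lemma upper_bid_nonneg:
  assumes "a \<ge> 0" "e \<ge> 0" shows "upper_bid a e G \<ge> 0"
proof (cases "candidates a e G = {}")
  case False
  then obtain b where "b \<in> candidates a e G" by auto
  with upper_bid_ge[OF this] show ?thesis by (auto simp: candidates_def)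
qed (use assms in \<open>simp add: upper_bid_def\<close>)

lemma value_mean_nonneg:
  assumes "\<And>s. vs s \<ge> 0" shows "value_mean \<gamma> vs ms n \<ge> 0"
  unfolding value_mean_def by (intro divide_nonneg_nonneg sum_nonneg assms) auto

lemma radius_nonneg:
  assumes "\<gamma> \<ge> 0" shows "radius \<gamma> vs ms n \<ge> 0"
proof -
  have "ln (real n) \<ge> 0" by (cases "n = 0") auto
  then show ?thesis unfolding radius_def using assms by simp
qed

lemma oucb_bid_in_unit:
  assumes "\<gamma> \<ge> 0" "\<And>s. vs s \<ge> 0" "t \<ge> 1"
  shows "oucb_bid \<gamma> vs ms t \<in> {0..1}"
proof (cases "t = 1")
  case False
  then obtain n where n: "t = Suc n" "n \<ge> 1" using assms(3) by (cases t) auto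
  then show ?thesis
    using upper_bid_le[of "value_mean \<gamma> vs ms n" "radius \<gamma> vs ms n" "ecdf_less ms n"]
      upper_bid_nonneg[OF value_mean_nonneg[of vs \<gamma> ms n] radius_nonneg[of \<gamma> vs ms n]] assms
    by (auto simp: oucb_bid_Suc)
qed simp

section \<open>Empirical distribution functions and their one-sided limits\<close>

lemma ecdf_less_bounds: "0 \<le> ecdf_less ms n b" "ecdf_less ms n b \<le> 1"
proof -
  have "card {s \<in> {1..n}. ms s < b} \<le> card {1..n}" by (intro card_mono) auto
  then show "ecdf_less ms n b \<le> 1"
    by (cases "n = 0") (auto simp: ecdf_less_def divide_simps)
qed (simp add: ecdf_less_def)

lemma ecdf_bounds: "0 \<le> ecdf ms n b" "ecdf ms n b \<le> 1"
proof -
  have "card {s \<in> {1..n}. ms s \<le> b} \<le> card {1..n}" by (intro card_mono) auto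
  then show "ecdf ms n b \<le> 1"
    by (cases "n = 0") (auto simp: ecdf_def divide_simps)
qed (simp add: ecdf_def)

lemma ecdf_less_mono: "b \<le> b' \<Longrightarrow> ecdf_less ms n b \<le> ecdf_less ms n b'"
  unfolding ecdf_less_def by (intro divide_right_mono of_nat_mono card_mono) auto

lemma ecdf_less_le_ecdf: "b \<le> b' \<Longrightarrow> ecdf_less ms n b \<le> ecdf ms n b'"
  unfolding ecdf_less_def ecdf_def by (intro divide_right_mono of_nat_mono card_mono) auto

lemma ecdf_le_ecdf_less: "b < b' \<Longrightarrow> ecdf ms n b \<le> ecdf_less ms n b'"
  unfolding ecdf_less_def ecdf_def by (intro divide_right_mono of_nat_mono card_mono) auto

lemma eventually_less_at_right: "x < c \<Longrightarrow> eventually (\<lambda>b. b < c) (at_right x)" for x c :: real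
  by (auto simp: eventually_at_right_field intro!: exI[of _ c])

lemma eventually_ecdf_less_at_left:
  "eventually (\<lambda>b. ecdf_less ms n b = ecdf_less ms n x) (at_left x)"
proof -
  have "eventually (\<lambda>b. \<forall>s\<in>{1..n}. (ms s < b) = (ms s < x)) (at_left x)"
  proof (intro eventually_ball_finite ballI)
    fix s
    show "eventually (\<lambda>b. (ms s < b) = (ms s < x)) (at_left x)"
    proof (cases "ms s < x")
      case True
      then have "eventually (\<lambda>b. ms s < b) (at_left x)"
        by (auto simp: eventually_at_left_field)
      then show ?thesis using True by (auto elim: eventually_mono)
    next
      case False
      then show ?thesis by (auto simp: eventually_at_left_field intro!: exI[of _ "x - 1"])
    qed
  qed simp
  then show ?thesis
  proof (rule eventually_mono)
    fix b assume "\<forall>s\<in>{1..n}. (ms s < b) = (ms s < x)"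
    then have "{s \<in> {1..n}. ms s < b} = {s \<in> {1..n}. ms s < x}" by auto
    then show "ecdf_less ms n b = ecdf_less ms n x" by (simp add: ecdf_less_def)
  qed
qed

lemma eventually_ecdf_less_at_right:
  "eventually (\<lambda>b. ecdf_less ms n b = ecdf ms n x) (at_right x)"
proof -
  have "eventually (\<lambda>b. \<forall>s\<in>{1..n}. (ms s < b) = (ms s \<le> x)) (at_right x)"
  proof (intro eventually_ball_finite ballI)
    fix s
    show "eventually (\<lambda>b. (ms s < b) = (ms s \<le> x)) (at_right x)"
    proof (cases "ms s \<le> x")
      case False
      then have "eventually (\<lambda>b. b < ms s) (at_right x)"
        by (intro eventually_less_at_right) simp
      then show ?thesis using False by (auto elim: eventually_mono)
    next
      case True
      then show ?thesis by (auto simp: eventually_at_right_field intro!: exI[of _ "x + 1"])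
    qed
  qed simp
  then show ?thesis
  proof (rule eventually_mono)
    fix b assume "\<forall>s\<in>{1..n}. (ms s < b) = (ms s \<le> x)"
    then have "{s \<in> {1..n}. ms s < b} = {s \<in> {1..n}. ms s \<le> x}" by auto
    then show "ecdf_less ms n b = ecdf ms n x" by (simp add: ecdf_less_def ecdf_def)
  qed
qed

lemma bdd_above_empirical_utility:
  "bdd_above ((\<lambda>b. (a - b) * ecdf_less ms n b) ` {0..1})"
proof (rule bdd_aboveI2[of _ _ "\<bar>a\<bar>"])
  fix b :: real assume "b \<in> {0..1}"
  then have "(a - b) * ecdf_less ms n b \<le> \<bar>a\<bar> * ecdf_less ms n b"
    using ecdf_less_bounds[of ms n b] by (intro mult_right_mono) auto
  also have "\<dots> \<le> \<bar>a\<bar> * 1"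
    using ecdf_less_bounds[of ms n b] by (intro mult_left_mono) auto
  finally show "(a - b) * ecdf_less ms n b \<le> \<bar>a\<bar>" by simp
qed

text \<open>The supremum is attained because the empirical utility is left-continuous.\<close>
lemma upper_bid_in_candidates:
  assumes "candidates a e (ecdf_less ms n) \<noteq> {}"
  shows "upper_bid a e (ecdf_less ms n) \<in> candidates a e (ecdf_less ms n)"
proof -
  let ?S = "candidates a e (ecdf_less ms n)"
  define B where "B = Sup ?S"
  have "B \<in> ?S"
  proof (rule ccontr)
    assume B: "B \<notin> ?S"
    obtain c where c: "c < B" "\<And>b. c < b \<Longrightarrow> b < B \<Longrightarrow> ecdf_less ms n b = ecdf_less ms n B"
      using eventually_ecdf_less_at_left[of ms n B] by (auto simp: eventually_at_left_field)
    define m where "m = (SUP b'\<in>{0..1}. (a - b') * ecdf_less ms n b') - 2 * e"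
    have close: "\<exists>b\<in>?S. max c d < b \<and> b < B" if "d < B" for d
    proof -
      have "max c d < Sup ?S" using c(1) that by (simp add: B_def)
      then obtain b where "b \<in> ?S" "max c d < b"
        using assms by (metis less_cSupD)
      moreover have "b \<le> B"
        unfolding B_def using \<open>b \<in> ?S\<close> by (intro cSup_upper bdd_above_candidates)
      ultimately show ?thesis using B by (metis order_le_less)
    qed
    have "m \<le> (a - B) * ecdf_less ms n B"
    proof (rule field_le_epsilon)
      fix r :: real assume "r > 0"
      then obtain b where b: "b \<in> ?S" "c < b" "B - r < b" "b < B"
        using close[of "B - r"] by auto
      have "m \<le> (a - b) * ecdf_less ms n B"
        using b c(2)[of b] by (auto simp: candidates_def m_def)
      also have "\<dots> = (a - B) * ecdf_less ms n B + (B - b) * ecdf_less ms n B"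
        by (simp add: algebra_simps)
      also have "(B - b) * ecdf_less ms n B \<le> r * 1"
        using b ecdf_less_bounds[of ms n B] by (intro mult_mono) auto
      finally show "m \<le> (a - B) * ecdf_less ms n B + r" by simp
    qed
    moreover have "B \<ge> 0"
      using close[OF c(1)] by (force simp: candidates_def)
    moreover have "B \<le> min 1 (a + e)"
      unfolding B_def by (intro cSup_least assms) (auto simp: candidates_def)
    ultimately show False
      using B by (auto simp: candidates_def m_def)
  qed
  then show ?thesis using assms by (simp add: upper_bid_def B_def)
qed

text \<open>A bid slightly above \<open>x\<close> also counts the observations equal to
  \<open>x\<close>, at vanishing extra cost; \<open>x < 1\<close> leaves room for such bids. This is
  how the empirical optimum is compared with \<open>ecdf\<close> at \<open>bstar\<close>.\<close>

lemma empirical_utility_sup_ge: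
  assumes "0 \<le> x" "x < 1"
  shows "(a - x) * ecdf ms n x \<le> (SUP b\<in>{0..1}. (a - b) * ecdf_less ms n b)"
proof (rule field_le_epsilon)
  fix r :: real assume r: "r > 0"
  have "eventually (\<lambda>b. ecdf_less ms n b = ecdf ms n x \<and> b < 1 \<and> b < x + r \<and> x < b) (at_right x)"
    using eventually_ecdf_less_at_right assms r
    by (intro eventually_conj) (auto intro: eventually_less_at_right eventually_at_right_less)
  then obtain b where b: "ecdf_less ms n b = ecdf ms n x" "b < 1" "b < x + r" "x < b"
    using eventually_happens[of _ "at_right x"] trivial_limit_at_right_real by blast
  have "(a - x) * ecdf ms n x = (a - b) * ecdf_less ms n b + (b - x) * ecdf ms n x"
    by (simp add: b algebra_simps)
  also have "(b - x) * ecdf ms n x \<le> r * 1"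
    using b ecdf_bounds[of ms n x] by (intro mult_mono) auto
  also have "(a - b) * ecdf_less ms n b \<le> (SUP b\<in>{0..1}. (a - b) * ecdf_less ms n b)"
    using b assms by (intro cSUP_upper bdd_above_empirical_utility) auto
  finally show "(a - x) * ecdf ms n x \<le> (SUP b\<in>{0..1}. (a - b) * ecdf_less ms n b) + r"
    by simp
qed

text \<open>If no bid above \<open>x\<close> were a candidate, the empirical optimum
  \<open>m\<close> would have to come from bids up to \<open>x\<close>, and \<open>lower\<close>
  would bound it by the utility at \<open>x\<close> plus \<open>2 * e - r\<close>. But a bid less
  than \<open>r\<close> to the right of \<open>x\<close> loses at most \<open>r\<close> against
  \<open>x\<close>, hence at most \<open>2 * e\<close> against \<open>m\<close>, and so is a
  candidate.\<close>

lemma candidate_gt: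
  assumes x: "0 \<le> x" "x < 1" "x < a + e" and e: "r > 0" "e > 0"
    and lower: "\<And>b. 0 \<le> b \<Longrightarrow> b \<le> x \<Longrightarrow>
      (a - b) * ecdf_less ms n b \<le> (a - x) * ecdf ms n x + 2 * e - r"
    and re: "r \<le> e"
  shows "\<exists>b\<in>candidates a e (ecdf_less ms n). x < b"
proof -
  let ?S = "candidates a e (ecdf_less ms n)"
  define m where "m = (SUP b\<in>{0..1}. (a - b) * ecdf_less ms n b)"
  show ?thesis
  proof (rule ccontr)
    assume none: "\<not> (\<exists>b\<in>?S. x < b)"
    define W where "W = (a - x) * ecdf ms n x + 2 * e - r"
    \<comment> \<open>Bids above \<open>a + e\<close> are excluded from the candidates whatever
      their utility. Their utility is at most 0, so a nonnegative \<open>W\<close> covers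
      them.\<close>
    have W0: "W \<ge> 0"
    proof -
      have "(- e) * ecdf ms n x \<le> (a - x) * ecdf ms n x"
        using x ecdf_bounds[of ms n x] by (intro mult_right_mono) auto
      moreover have "e * ecdf ms n x \<le> e * 1"
        using e ecdf_bounds[of ms n x] by (intro mult_left_mono) auto
      ultimately show ?thesis using re by (simp add: W_def)
    qed
    have "(a - b) * ecdf_less ms n b \<le> max (m - 2 * e) W" if b: "b \<in> {0..1}" for b
    proof -
      consider "b \<le> x" | "x < b" "b \<le> a + e" | "b > a + e" by linarith
      then show ?thesis
      proof cases
        case 1
        then show ?thesis using lower[of b] b by (simp add: W_def)
      next
        case 2
        then have "b \<notin> ?S" using none by blast
        then show ?thesis using 2 b by (auto simp: candidates_def m_def)
      next
        case 3
        then have "(a - b) * ecdf_less ms n b \<le> 0"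
          using e ecdf_less_bounds[of ms n b] by (intro mult_nonpos_nonneg) auto
        then show ?thesis using W0 by simp
      qed
    qed
    then have "m \<le> max (m - 2 * e) W"
      unfolding m_def by (intro cSUP_least) auto
    then have mW: "m \<le> W" using e by simp
    have "eventually (\<lambda>b. ecdf_less ms n b = ecdf ms n x \<and> b < 1 \<and> b < x + r \<and> b < a + e \<and> x < b)
        (at_right x)"
      using eventually_ecdf_less_at_right x e
      by (intro eventually_conj) (auto intro: eventually_less_at_right eventually_at_right_less)
    then obtain b where b: "ecdf_less ms n b = ecdf ms n x" "b < 1" "b < x + r" "b < a + e" "x < b"
      using eventually_happens[of _ "at_right x"] trivial_limit_at_right_real by blast
    have "(b - x) * ecdf ms n x \<le> r * 1"
      using b ecdf_bounds[of ms n x] by (intro mult_mono) auto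
    then have "m - 2 * e \<le> (a - b) * ecdf_less ms n b"
      using mW by (simp add: b(1) W_def algebra_simps)
    then have "b \<in> ?S" using b x by (simp add: candidates_def m_def)
    with none b show False by blast
  qed
qed

text \<open>At successive wins the count runs through 1, 2, ... once each, because the radius of a
  round uses the count before that round. The sum is therefore that of \<open>1 / sqrt k\<close>
  over \<open>k\<close> below the final count, and it telescopes against
  \<open>2 * sqrt (k - 1)\<close>.\<close>

lemma sum_wins_le:
  assumes "ms 1 \<le> 1" "T \<ge> 1"
  shows "(\<Sum>n\<in>{1..<T}. if ms (Suc n) \<le> oucb_bid \<gamma> vs ms (Suc n)
            then 1 / sqrt (real (win_count \<gamma> vs ms n)) else 0)
         \<le> 2 * sqrt (real (win_count \<gamma> vs ms T) - 1)"
  using assms(2)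
proof (induction T rule: dec_induct)
  case base
  then show ?case using win_count_pos[of 1 ms \<gamma> vs] assms by simp
next
  case (step T)
  define k where "k = win_count \<gamma> vs ms T"
  have k: "k \<ge> 1" unfolding k_def using step assms by (intro win_count_pos) auto
  \<comment> \<open>After multiplication by \<open>sqrt k\<close> this is the inequality of
    arithmetic and geometric means for \<open>k\<close> and \<open>k - 1\<close>.\<close>
  have key: "2 * sqrt (real k - 1) + 1 / sqrt (real k) \<le> 2 * sqrt (real k)"
  proof -
    have "sqrt (real k) * sqrt (real k - 1) = sqrt (real k * (real k - 1))"
      by (simp add: real_sqrt_mult)
    also have "\<dots> \<le> real k - 1 / 2"
      using k by (intro real_le_lsqrt) (auto simp: power2_eq_square algebra_simps)
    finally have "2 * (sqrt (real k) * sqrt (real k - 1)) + 1 \<le> 2 * (sqrt (real k) * sqrt (real k))"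
      using k by simp
    then show ?thesis
      using k by (simp add: field_simps del: real_sqrt_mult_self)
  qed
  show ?case
  proof (cases "ms (Suc T) \<le> oucb_bid \<gamma> vs ms (Suc T)")
    case True
    then have "win_count \<gamma> vs ms (Suc T) = k + 1" by (simp add: win_count_Suc k_def)
    then show ?thesis
      using step key True by (simp add: k_def)
  next
    case False
    then show ?thesis using step by (simp add: win_count_Suc)
  qed
qed

section \<open>Measurability\<close>

lemma real_card_filter: "finite A \<Longrightarrow> real (card {s \<in> A. Q s}) = (\<Sum>s\<in>A. if Q s then 1 else 0)"
  by (simp add: sum.inter_filter[symmetric])

text \<open>The empirical utility is non-increasing between consecutive observations, so that a point can be
  moved to a rational on its left.\<close>
lemma rational_left_of:
  assumes "b > 0" "c < b"
  shows "\<exists>r::rat. of_rat r > c \<and> of_rat r > (0::real) \<and> of_rat r < b \<and>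
    (a - b) * ecdf_less ms n b \<le> (a - of_rat r) * ecdf_less ms n (of_rat r)"
proof -
  obtain d where d: "d < b" "\<And>y. d < y \<Longrightarrow> y < b \<Longrightarrow> ecdf_less ms n y = ecdf_less ms n b"
    using eventually_ecdf_less_at_left[of ms n b] by (auto simp: eventually_at_left_field)
  have "max (max c d) 0 < b" using d assms by simp
  then obtain r where r: "max (max c d) 0 < of_rat r" "of_rat r < b"
    using of_rat_dense by blast
  then have "ecdf_less ms n (of_rat r) = ecdf_less ms n b" by (intro d) auto
  then have "(a - b) * ecdf_less ms n b \<le> (a - of_rat r) * ecdf_less ms n (of_rat r)"
    using r ecdf_less_bounds[of ms n b] by (auto intro!: mult_right_mono)
  then show ?thesis using r by auto
qed

text \<open>Turns the supremum over an interval into countably many conditions, which is what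
  measurability needs.\<close>

lemma candidates_iff_rat:
  "b \<in> candidates a e (ecdf_less ms n) \<longleftrightarrow> 0 \<le> b \<and> b \<le> 1 \<and> b \<le> a + e \<and>
     (\<forall>r::rat. 0 \<le> r \<longrightarrow> r \<le> 1 \<longrightarrow>
       (a - of_rat r) * ecdf_less ms n (of_rat r) - 2 * e \<le> (a - b) * ecdf_less ms n b)"
proof -
  let ?h = "\<lambda>b. (a - b) * ecdf_less ms n b"
  have "(SUP b'\<in>{0..1}. ?h b') - 2 * e \<le> ?h b \<longleftrightarrow> (SUP b'\<in>{0..1}. ?h b') \<le> ?h b + 2 * e"
    by linarith
  also have "\<dots> \<longleftrightarrow> (\<forall>b'\<in>{0..1}. ?h b' \<le> ?h b + 2 * e)"
    by (intro cSUP_le_iff bdd_above_empirical_utility) auto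
  also have "\<dots> \<longleftrightarrow> (\<forall>r::rat. 0 \<le> r \<longrightarrow> r \<le> 1 \<longrightarrow> ?h (of_rat r) \<le> ?h b + 2 * e)"
  proof safe
    fix r :: rat assume "\<forall>b'\<in>{0..1}. ?h b' \<le> ?h b + 2 * e" "0 \<le> r" "r \<le> 1"
    then show "?h (of_rat r) \<le> ?h b + 2 * e" by simp
  next
    fix x :: real
    assume *: "\<forall>r::rat. 0 \<le> r \<longrightarrow> r \<le> 1 \<longrightarrow> ?h (of_rat r) \<le> ?h b + 2 * e" and x: "x \<in> {0..1}"
    show "?h x \<le> ?h b + 2 * e"
    proof (cases "x = 0")
      case True
      then show ?thesis using *[rule_format, of 0] by simp
    next
      case False
      then obtain r :: rat where r: "of_rat r > (0::real)" "of_rat r < x" "?h x \<le> ?h (of_rat r)"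
        using rational_left_of[of x 0 a ms n] x by auto
      then have "of_rat r < (1::real)" using x unfolding atLeastAtMost_iff by linarith
      then have "?h (of_rat r) \<le> ?h b + 2 * e" using * r by auto
      then show ?thesis using r by linarith
    qed
  qed
  finally show ?thesis by (auto simp: candidates_def diff_le_eq)
qed

text \<open>A nonempty candidate set contains its supremum, and any candidate can be moved to a
  rational candidate slightly to its left. Hence rational candidates detect both whether the set is
  empty and whether its supremum exceeds \<open>c\<close>.\<close>

lemma upper_bid_gt_iff_rat:
  "c < upper_bid a e (ecdf_less ms n) \<longleftrightarrow>
     (\<exists>r::rat. of_rat r \<in> candidates a e (ecdf_less ms n) \<and> c < of_rat r) \<or>
     (\<forall>r::rat. of_rat r \<notin> candidates a e (ecdf_less ms n)) \<and> c < 1 \<and> c < a + e"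
proof -
  let ?S = "candidates a e (ecdf_less ms n)" and ?h = "\<lambda>b. (a - b) * ecdf_less ms n b"
  have rat: "\<exists>r::rat. of_rat r \<in> ?S \<and> c < of_rat r" if b: "b \<in> ?S" "c < b" for b c
  proof (cases "b = 0")
    \<comment> \<open>The bid 0 cannot be moved to the left within the range of bids, but it is
      rational itself.\<close>
    case True
    then show ?thesis using b by (intro exI[of _ 0]) auto
  next
    case False
    then have "b > 0" using b by (auto simp: candidates_def)
    then obtain r :: rat where r: "of_rat r > c" "of_rat r > (0::real)" "of_rat r < b"
        "?h b \<le> ?h (of_rat r)"
      using rational_left_of[of b c a ms n] b by blast
    moreover have "of_rat r \<le> (1::real)"
      using b r(3) by (simp only: candidates_def mem_Collect_eq atLeastAtMost_iff) linarith
    ultimately have "of_rat r \<in> ?S" using b by (auto simp: candidates_def)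
    then show ?thesis using r by blast
  qed
  show ?thesis
  proof (cases "?S = {}")
    case True
    then show ?thesis by (simp add: upper_bid_def)
  next
    case False
    then obtain b where "b \<in> ?S" by blast
    then obtain r0 :: rat where "of_rat r0 \<in> ?S" using rat[of b "b - 1"] by auto
    moreover have "c < upper_bid a e (ecdf_less ms n) \<longleftrightarrow> (\<exists>r::rat. of_rat r \<in> ?S \<and> c < of_rat r)"
      using rat[OF upper_bid_in_candidates[OF False]] upper_bid_ge by (meson less_le_trans)
    ultimately show ?thesis by blast
  qed
qed

lemma measurable_ecdf_less:
  assumes [measurable]: "\<And>s. ms s \<in> borel_measurable M"
  shows "(\<lambda>\<omega>. ecdf_less (\<lambda>s. ms s \<omega>) n b) \<in> borel_measurable M"
  unfolding ecdf_less_def by (subst real_card_filter) simp_all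

lemma measurable_ecdf:
  assumes [measurable]: "\<And>s. ms s \<in> borel_measurable M"
  shows "(\<lambda>\<omega>. ecdf (\<lambda>s. ms s \<omega>) n b) \<in> borel_measurable M"
  unfolding ecdf_def by (subst real_card_filter) simp_all

lemma measurable_upper_bid:
  assumes [measurable]: "a \<in> borel_measurable M" "e \<in> borel_measurable M"
    "\<And>s. ms s \<in> borel_measurable M"
  shows "(\<lambda>\<omega>. upper_bid (a \<omega>) (e \<omega>) (ecdf_less (\<lambda>s. ms s \<omega>) n)) \<in> borel_measurable M"
proof (rule borel_measurableI_greater)
  fix c
  note measurable_ecdf_less[OF assms(3), measurable]
  have "Measurable.pred M (\<lambda>\<omega>. c < upper_bid (a \<omega>) (e \<omega>) (ecdf_less (\<lambda>s. ms s \<omega>) n))"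
    unfolding upper_bid_gt_iff_rat candidates_iff_rat by measurable
  then show "{\<omega> \<in> space M. c < upper_bid (a \<omega>) (e \<omega>) (ecdf_less (\<lambda>s. ms s \<omega>) n)} \<in> sets M"
    by (simp add: pred_def)
qed

context
  fixes M :: "'a measure" and vs ms :: "nat \<Rightarrow> 'a \<Rightarrow> real" and \<gamma> :: real
  assumes meas [measurable]: "\<And>s. vs s \<in> borel_measurable M" "\<And>s. ms s \<in> borel_measurable M"
begin

lemma measurable_win_stats:
  assumes [measurable]: "\<And>s. s \<in> {1..n} \<Longrightarrow>
    (\<lambda>\<omega>. oucb_bid \<gamma> (\<lambda>s. vs s \<omega>) (\<lambda>s. ms s \<omega>) s) \<in> borel_measurable M"
  shows "(\<lambda>\<omega>. real (win_count \<gamma> (\<lambda>s. vs s \<omega>) (\<lambda>s. ms s \<omega>) n)) \<in> borel_measurable M" (is ?count)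
    and "(\<lambda>\<omega>. \<Sum>s\<in>win_set \<gamma> (\<lambda>s. vs s \<omega>) (\<lambda>s. ms s \<omega>) n. vs s \<omega>) \<in> borel_measurable M" (is ?sum)
proof -
  show ?count
    unfolding win_count_def win_set_def
    by (subst real_card_filter) (auto intro!: borel_measurable_sum measurable_If)
  show ?sum
    unfolding win_set_def
    by (subst sum.inter_filter) (auto intro!: borel_measurable_sum measurable_If)
qed

text \<open>The measure space is left arbitrary because the bid is needed both as a random variable
  on the sample space and as a function on a product of coordinates.\<close>

lemma measurable_oucb_bid [measurable]:
  "(\<lambda>\<omega>. oucb_bid \<gamma> (\<lambda>s. vs s \<omega>) (\<lambda>s. ms s \<omega>) t) \<in> borel_measurable M"
proof (induction t rule: less_induct)
  case (less t)
  show ?case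
  proof (cases "t \<le> 1")
    case True
    then consider "t = 0" | "t = 1" by linarith
    then show ?thesis by cases (auto simp: oucb_bid_def[of _ _ _ 0])
  next
    case False
    then obtain n where n: "t = Suc n" "n \<ge> 1" by (cases t) auto
    have IH: "(\<lambda>\<omega>. oucb_bid \<gamma> (\<lambda>s. vs s \<omega>) (\<lambda>s. ms s \<omega>) s) \<in> borel_measurable M"
      if "s \<in> {1..n}" for s
      using that n by (intro less.IH) auto
    note [measurable] = measurable_win_stats[OF IH]
    show ?thesis
      unfolding n(1) oucb_bid_Suc[OF n(2)]
      by (rule measurable_upper_bid) (simp_all add: value_mean_def radius_def)
  qed
qed

lemmas measurable_win_count [measurable] = measurable_win_stats(1)[OF measurable_oucb_bid]
lemmas measurable_win_sum [measurable] = measurable_win_stats(2)[OF measurable_oucb_bid]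

lemma measurable_radius [measurable]:
  "(\<lambda>\<omega>. radius \<gamma> (\<lambda>s. vs s \<omega>) (\<lambda>s. ms s \<omega>) n) \<in> borel_measurable M"
  unfolding radius_def by measurable

end

section \<open>Independence and exponential bounds\<close>

text \<open>Fubini's theorem on the product of the two laws: \<open>X\<close> is frozen and
  \<open>Y\<close> is integrated out. Together with the coordinate version below it takes the place
  of conditional expectations.\<close>

lemma (in prob_space) indep_var_nn_integral:
  fixes g :: "_ \<Rightarrow> ennreal"
  assumes ind: "indep_var S X N Y" and g [measurable]: "g \<in> borel_measurable (S \<Otimes>\<^sub>M N)"
  shows "(\<integral>\<^sup>+\<omega>. g (X \<omega>, Y \<omega>) \<partial>M) = (\<integral>\<^sup>+\<omega>. (\<integral>\<^sup>+\<omega>'. g (X \<omega>, Y \<omega>') \<partial>M) \<partial>M)"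
proof -
  have [measurable]: "X \<in> measurable M S" "Y \<in> measurable M N"
    and joint: "distr M S X \<Otimes>\<^sub>M distr M N Y = distr M (S \<Otimes>\<^sub>M N) (\<lambda>x. (X x, Y x))"
    using ind by (auto simp: indep_var_distribution_eq)
  interpret Y: prob_space "distr M N Y" by (rule prob_space_distr) simp
  have "(\<integral>\<^sup>+\<omega>. g (X \<omega>, Y \<omega>) \<partial>M) = (\<integral>\<^sup>+z. g z \<partial>distr M (S \<Otimes>\<^sub>M N) (\<lambda>x. (X x, Y x)))"
    by (subst nn_integral_distr) auto
  also have "\<dots> = (\<integral>\<^sup>+z. g z \<partial>(distr M S X \<Otimes>\<^sub>M distr M N Y))"
    by (simp add: joint)
  also have "\<dots> = (\<integral>\<^sup>+x. (\<integral>\<^sup>+y. g (x, y) \<partial>distr M N Y) \<partial>distr M S X)"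
    by (subst Y.nn_integral_fst) auto
  also have "\<dots> = (\<integral>\<^sup>+x. (\<integral>\<^sup>+\<omega>'. g (x, Y \<omega>') \<partial>M) \<partial>distr M S X)"
    by (auto intro!: nn_integral_cong simp: nn_integral_distr)
  also have "\<dots> = (\<integral>\<^sup>+\<omega>. (\<integral>\<^sup>+\<omega>'. g (X \<omega>, Y \<omega>') \<partial>M) \<partial>M)"
    by (subst nn_integral_distr) auto
  finally show ?thesis .
qed

text \<open>Indices outside \<open>I\<close> are included since the bidding rule is applied to
  entire sequences, the removed coordinate among them; there a component is constantly
  \<open>undefined\<close>.\<close>

lemma measurable_component_PiM [measurable]:
  "(\<lambda>x. x i) \<in> borel_measurable (PiM I (\<lambda>_. borel :: real measure))"
proof (cases "i \<in> I")
  case False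
  have "(\<lambda>x. x i) \<in> borel_measurable (PiM I (\<lambda>_. borel :: real measure)) \<longleftrightarrow>
      (\<lambda>x. undefined :: real) \<in> borel_measurable (PiM I (\<lambda>_. borel :: real measure))"
    using False by (intro measurable_cong) (auto simp: space_PiM PiE_def extensional_def)
  then show ?thesis by simp
qed simp

lemma (in prob_space) indep_vars_nn_integral_coordinate:
  fixes X :: "'i \<Rightarrow> 'a \<Rightarrow> real" and g :: "_ \<Rightarrow> ennreal"
  assumes ind: "indep_vars (\<lambda>_. borel) X UNIV"
    and g: "g \<in> borel_measurable (PiM (- {i}) (\<lambda>_. borel) \<Otimes>\<^sub>M borel)"
  shows "(\<integral>\<^sup>+\<omega>. g (restrict (\<lambda>j. X j \<omega>) (- {i}), X i \<omega>) \<partial>M) =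
    (\<integral>\<^sup>+\<omega>. (\<integral>\<^sup>+\<omega>'. g (restrict (\<lambda>j. X j \<omega>) (- {i}), X i \<omega>') \<partial>M) \<partial>M)"
proof -
  have "indep_var (PiM (- {i}) (\<lambda>_. borel)) (\<lambda>\<omega>. restrict (\<lambda>j. X j \<omega>) (- {i}))
      (PiM {i} (\<lambda>_. borel)) (\<lambda>\<omega>. restrict (\<lambda>j. X j \<omega>) {i})"
    by (rule indep_var_restrict[OF ind]) auto
  moreover have "(\<lambda>z. g (fst z, snd z i)) \<in> borel_measurable
      (PiM (- {i}) (\<lambda>_. borel) \<Otimes>\<^sub>M PiM {i} (\<lambda>_. borel))"
    using g by measurable
  ultimately show ?thesis
    using indep_var_nn_integral by fastforce
qed

lemma (in prob_space) chernoff_iid: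
  fixes X :: "nat \<Rightarrow> 'a \<Rightarrow> real"
  assumes ind: "indep_vars (\<lambda>_. borel) X UNIV"
    and distr_eq: "\<And>s. distr M borel (X s) = distr M borel (X 0)"
    and f [measurable]: "f \<in> borel_measurable borel"
    and mgf: "(\<integral>\<^sup>+\<omega>. exp (f (X 0 \<omega>)) \<partial>M) \<le> ennreal (exp c)"
  shows "prob {\<omega> \<in> space M. (\<Sum>s=1..n. f (X s \<omega>)) \<ge> x} \<le> exp (real n * c - x)"
proof -
  have X [measurable]: "X s \<in> borel_measurable M" for s
    using ind by (auto simp: indep_vars_def)
  have ind': "indep_vars (\<lambda>_. borel) (\<lambda>s \<omega>. exp (f (X s \<omega>))) {1..n}"
    by (rule indep_vars_compose2[OF indep_vars_subset[OF ind]]) auto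
  have one: "(\<integral>\<^sup>+\<omega>. exp (f (X s \<omega>)) \<partial>M) \<le> ennreal (exp c)" for s
  proof -
    have "(\<integral>\<^sup>+\<omega>. exp (f (X s \<omega>)) \<partial>M) = (\<integral>\<^sup>+y. exp (f y) \<partial>distr M borel (X s))"
      by (subst nn_integral_distr) auto
    also have "\<dots> = (\<integral>\<^sup>+y. exp (f y) \<partial>distr M borel (X 0))"
      by (simp only: distr_eq[of s])
    also have "\<dots> = (\<integral>\<^sup>+\<omega>. exp (f (X 0 \<omega>)) \<partial>M)"
      by (subst nn_integral_distr) auto
    finally show ?thesis using mgf by simp
  qed
  let ?A = "{\<omega> \<in> space M. (\<Sum>s=1..n. f (X s \<omega>)) \<ge> x}"
  have "emeasure M ?A = (\<integral>\<^sup>+\<omega>. indicator ?A \<omega> \<partial>M)" by simp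
  also have "\<dots> \<le> (\<integral>\<^sup>+\<omega>. ennreal (exp (- x)) * ennreal (\<Prod>s=1..n. exp (f (X s \<omega>))) \<partial>M)"
  proof (rule nn_integral_mono)
    fix \<omega> assume "\<omega> \<in> space M"
    show "indicator ?A \<omega> \<le> ennreal (exp (- x)) * ennreal (\<Prod>s=1..n. exp (f (X s \<omega>)))"
    proof (cases "\<omega> \<in> ?A")
      case True
      then have "1 \<le> exp (- x + (\<Sum>s=1..n. f (X s \<omega>)))" by simp
      also have "\<dots> = exp (- x) * (\<Prod>s=1..n. exp (f (X s \<omega>)))"
        unfolding exp_add by (simp add: exp_sum)
      finally show ?thesis
        using True by (simp add: ennreal_mult[symmetric] prod_nonneg)
    qed simp
  qed
  also have "\<dots> = ennreal (exp (- x)) * (\<integral>\<^sup>+\<omega>. ennreal (\<Prod>s=1..n. exp (f (X s \<omega>))) \<partial>M)"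
    by (rule nn_integral_cmult) measurable
  also have "(\<integral>\<^sup>+\<omega>. ennreal (\<Prod>s=1..n. exp (f (X s \<omega>))) \<partial>M)
      = (\<integral>\<^sup>+\<omega>. (\<Prod>s=1..n. ennreal (exp (f (X s \<omega>)))) \<partial>M)"
    by (simp add: prod_ennreal)
  also have "\<dots> = (\<Prod>s=1..n. \<integral>\<^sup>+\<omega>. ennreal (exp (f (X s \<omega>))) \<partial>M)"
    using indep_vars_nn_integral[of "{1..n}" "\<lambda>s \<omega>. ennreal (exp (f (X s \<omega>)))"]
      indep_vars_compose2[OF ind', of "\<lambda>_. ennreal" "\<lambda>_. borel"] by auto
  also have "\<dots> \<le> (\<Prod>s=1..n. ennreal (exp c))"
    by (intro prod_mono_ennreal one)
  also have "\<dots> = ennreal (exp (real n * c))"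
    by (simp add: ennreal_power exp_of_nat_mult)
  finally have "emeasure M ?A \<le> ennreal (exp (- x)) * ennreal (exp (real n * c))"
    by (simp add: mult_left_mono)
  also have "\<dots> = ennreal (exp (real n * c - x))"
    by (simp add: ennreal_mult[symmetric] exp_add[symmetric])
  finally show ?thesis
    by (simp add: emeasure_eq_measure)
qed

lemma (in prob_space) mgf_unit_interval:
  fixes Y :: "'a \<Rightarrow> real"
  assumes [measurable]: "Y \<in> borel_measurable M" and range: "\<And>\<omega>. \<omega> \<in> space M \<Longrightarrow> Y \<omega> \<in> {0..1}"
  shows "(\<integral>\<^sup>+\<omega>. exp (l * (Y \<omega> - expectation Y)) \<partial>M) \<le> ennreal (exp (l\<^sup>2 / 8))"
proof -
  \<comment> \<open>Hoeffding's lemma for positive \<open>l\<close> on any interval of length 1. A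
    negative \<open>l\<close> is handled by reflecting \<open>Y\<close>, whose range becomes the
    interval from -1 to 0.\<close>
  have pos: "(\<integral>\<^sup>+\<omega>. exp (l * (Z \<omega> - expectation Z)) \<partial>M) \<le> ennreal (exp (l\<^sup>2 / 8))"
    if "l > 0" and [measurable]: "Z \<in> borel_measurable M"
      and Z: "\<And>\<omega>. \<omega> \<in> space M \<Longrightarrow> Z \<omega> \<in> {a..a+1}" for l a and Z :: "'a \<Rightarrow> real"
  proof -
    interpret interval_bounded_random_variable M Z a "a + 1"
      by unfold_locales (use Z in auto)
    show ?thesis using Hoeffdings_lemma_nn_integral[OF \<open>l > 0\<close>] by simp
  qed
  consider "l > 0" | "l = 0" | "l < 0" by linarith
  then show ?thesis
  proof cases
    case 1
    then show ?thesis using pos[of l Y 0] range by simp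
  next
    case 2
    then show ?thesis by (simp add: emeasure_space_1)
  next
    case 3
    have "l * (Y \<omega> - expectation Y) = (- l) * (- Y \<omega> - expectation (\<lambda>\<omega>. - Y \<omega>))" for \<omega>
      by (simp add: algebra_simps)
    moreover have "(\<integral>\<^sup>+\<omega>. exp ((- l) * (- Y \<omega> - expectation (\<lambda>\<omega>. - Y \<omega>))) \<partial>M) \<le> ennreal (exp ((- l)\<^sup>2 / 8))"
      using 3 range by (intro pos[of "- l" "\<lambda>\<omega>. - Y \<omega>" "- 1"]) auto
    ultimately show ?thesis by simp
  qed
qed

section \<open>Supermartingale of the observed values\<close>

text \<open>Rounds start at 1; \<open>V 0\<close> and \<open>Mc 0\<close> represent the common laws.
  Values and competing bids form one independent family over a sum type, so that any single
  coordinate can be split off.\<close>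

locale first_price_auction = prob_space P for P :: "'a measure" +
  fixes V Mc :: "nat \<Rightarrow> 'a \<Rightarrow> real" and v \<gamma> :: real and F :: "real \<Rightarrow> real"
  assumes indep: "indep_vars (\<lambda>_. borel)
      (\<lambda>i. case i of Inl t \<Rightarrow> V t | Inr t \<Rightarrow> Mc t) (UNIV :: (nat + nat) set)"
    and V_id: "\<And>t. distr P borel (V t) = distr P borel (V 0)"
    and M_id: "\<And>t. distr P borel (Mc t) = distr P borel (Mc 0)"
    and V_range: "\<And>t \<omega>. \<omega> \<in> space P \<Longrightarrow> V t \<omega> \<in> {0..1}"
    and M_range: "\<And>t \<omega>. \<omega> \<in> space P \<Longrightarrow> Mc t \<omega> \<in> {0..1}"
    and v_mean: "expectation (V 0) = v"
    and F_cdf: "\<And>b. F b = prob {\<omega> \<in> space P. Mc 0 \<omega> \<le> b}"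
    and \<gamma>: "\<gamma> > 1"
begin

abbreviation bid :: "nat \<Rightarrow> 'a \<Rightarrow> real" where
  "bid t \<omega> \<equiv> oucb_bid \<gamma> (\<lambda>s. V s \<omega>) (\<lambda>s. Mc s \<omega>) t"

abbreviation won :: "nat \<Rightarrow> 'a \<Rightarrow> nat set" where
  "won n \<omega> \<equiv> win_set \<gamma> (\<lambda>s. V s \<omega>) (\<lambda>s. Mc s \<omega>) n"

abbreviation wins :: "nat \<Rightarrow> 'a \<Rightarrow> nat" where
  "wins n \<omega> \<equiv> win_count \<gamma> (\<lambda>s. V s \<omega>) (\<lambda>s. Mc s \<omega>) n"

abbreviation rad :: "nat \<Rightarrow> 'a \<Rightarrow> real" where
  "rad n \<omega> \<equiv> radius \<gamma> (\<lambda>s. V s \<omega>) (\<lambda>s. Mc s \<omega>) n"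

abbreviation vmean :: "nat \<Rightarrow> 'a \<Rightarrow> real" where
  "vmean n \<omega> \<equiv> value_mean \<gamma> (\<lambda>s. V s \<omega>) (\<lambda>s. Mc s \<omega>) n"

abbreviation (input) joint :: "nat + nat \<Rightarrow> 'a \<Rightarrow> real" where
  "joint \<equiv> (\<lambda>i. case i of Inl t \<Rightarrow> V t | Inr t \<Rightarrow> Mc t)"

lemma V_measurable [measurable]: "V s \<in> borel_measurable P"
  using indep unfolding indep_vars_def by (auto dest: spec[of _ "Inl s"])

lemma Mc_measurable [measurable]: "Mc s \<in> borel_measurable P"
  using indep unfolding indep_vars_def by (auto dest: spec[of _ "Inr s"])

lemma Mc_indep: "indep_vars (\<lambda>_. borel) Mc UNIV"
proof -
  have "indep_vars (\<lambda>s. PiM {Inr s} (\<lambda>_. borel)) (\<lambda>s \<omega>. restrict (\<lambda>i. joint i \<omega>) {Inr s}) UNIV"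
    by (rule indep_vars_restrict[OF indep]) (auto simp: disjoint_family_on_def)
  from indep_vars_compose2[OF this, of "\<lambda>s x. x (Inr s)" "\<lambda>_. borel"]
  show ?thesis by simp
qed

lemma F_eq: "prob {\<omega> \<in> space P. Mc s \<omega> \<le> b} = F b"
proof -
  have *: "prob {\<omega> \<in> space P. Mc s \<omega> \<le> b} = measure (distr P borel (Mc s)) {..b}" for s
    by (subst measure_distr) (auto intro!: arg_cong[of _ _ prob])
  show ?thesis unfolding F_cdf * by (simp only: M_id[of s])
qed

lemma F_mono: "b \<le> b' \<Longrightarrow> F b \<le> F b'"
  unfolding F_cdf by (intro finite_measure_mono) auto

lemma F_bounds: "0 \<le> F b" "F b \<le> 1"
  by (auto simp: F_cdf)

lemma F_measurable [measurable]: "F \<in> borel_measurable borel"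
  by (intro borel_measurable_mono monoI F_mono)

lemma v_bounds: "0 \<le> v" "v \<le> 1"
proof -
  have "integrable P (V 0)"
    using V_range by (intro integrable_const_bound[of _ 1]) auto
  then show "v \<le> 1" "0 \<le> v"
    unfolding v_mean[symmetric] using V_range
    by (auto intro!: integral_le_const integral_ge_const)
qed

lemma V_mean: "expectation (V s) = v"
proof -
  have *: "expectation (V s) = (\<integral>y. y \<partial>distr P borel (V s))" for s
    by (subst integral_distr) auto
  show ?thesis unfolding * V_id[of s] by (simp add: *[symmetric] v_mean)
qed

lemma bid_in_unit: "\<omega> \<in> space P \<Longrightarrow> t \<ge> 1 \<Longrightarrow> bid t \<omega> \<in> {0..1}"
  using V_range \<gamma> by (intro oucb_bid_in_unit) auto

lemma wins_pos: "\<omega> \<in> space P \<Longrightarrow> n \<ge> 1 \<Longrightarrow> wins n \<omega> \<ge> 1"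
  using M_range by (intro win_count_pos) auto

lemma bid_measurable [measurable]: "bid t \<in> borel_measurable P"
  by (rule measurable_oucb_bid) auto

lemma wins_measurable [measurable]: "(\<lambda>\<omega>. real (wins n \<omega>)) \<in> borel_measurable P"
  by (rule measurable_win_count) auto

lemma rad_measurable [measurable]: "rad n \<in> borel_measurable P"
  by (rule measurable_radius) auto

lemma won_sum_measurable [measurable]:
  "(\<lambda>\<omega>. \<Sum>s\<in>won n \<omega>. V s \<omega>) \<in> borel_measurable P"
  by (rule measurable_win_sum) auto

definition dev :: "nat \<Rightarrow> 'a \<Rightarrow> real" where
  "dev n \<omega> = (\<Sum>s\<in>won n \<omega>. V s \<omega>) - v * real (wins n \<omega>)"

lemma dev_measurable [measurable]: "dev n \<in> borel_measurable P"
  unfolding dev_def by measurable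

text \<open>Restriction replaces coordinate \<open>i\<close> by \<open>undefined\<close>. As
  \<open>i\<close> belongs to none of the first \<open>n\<close> rounds, nothing computed from those
  rounds notices.\<close>

lemma past_restrict:
  assumes "i \<notin> Inl ` {1..n} \<union> Inr ` {1..n}"
  defines "x \<equiv> \<lambda>\<omega>. restrict (\<lambda>j. joint j \<omega>) (- {i})"
  shows "win_set \<gamma> (\<lambda>s. x \<omega> (Inl s)) (\<lambda>s. x \<omega> (Inr s)) n = won n \<omega>"
    and "win_count \<gamma> (\<lambda>s. x \<omega> (Inl s)) (\<lambda>s. x \<omega> (Inr s)) n = wins n \<omega>"
    and "radius \<gamma> (\<lambda>s. x \<omega> (Inl s)) (\<lambda>s. x \<omega> (Inr s)) n = rad n \<omega>"
    and "oucb_bid \<gamma> (\<lambda>s. x \<omega> (Inl s)) (\<lambda>s. x \<omega> (Inr s)) (Suc n) = bid (Suc n) \<omega>"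
    and "s \<in> {1..n} \<Longrightarrow> x \<omega> (Inl s) = V s \<omega>"
proof -
  have V: "x \<omega> (Inl s) = V s \<omega>" if "s \<in> {1..n}" for s
    using that assms(1) by (auto simp: x_def)
  have M: "x \<omega> (Inr s) = Mc s \<omega>" if "s \<in> {1..n}" for s
    using that assms(1) by (auto simp: x_def)
  show w: "win_set \<gamma> (\<lambda>s. x \<omega> (Inl s)) (\<lambda>s. x \<omega> (Inr s)) n = won n \<omega>"
    by (intro win_set_cong V M)
  show "win_count \<gamma> (\<lambda>s. x \<omega> (Inl s)) (\<lambda>s. x \<omega> (Inr s)) n = wins n \<omega>"
    and "radius \<gamma> (\<lambda>s. x \<omega> (Inl s)) (\<lambda>s. x \<omega> (Inr s)) n = rad n \<omega>"
    by (simp_all add: win_count_def radius_def w)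
  show "oucb_bid \<gamma> (\<lambda>s. x \<omega> (Inl s)) (\<lambda>s. x \<omega> (Inr s)) (Suc n) = bid (Suc n) \<omega>"
    by (intro oucb_bid_cong V M) auto
  show "s \<in> {1..n} \<Longrightarrow> x \<omega> (Inl s) = V s \<omega>" by (rule V)
qed

lemma won_subset: "won n \<omega> \<subseteq> {1..n}"
  by (auto simp: win_set_def)

text \<open>The value of round \<open>n + 1\<close> is independent of the past and of the event of winning that round, so
  this exponential is a supermartingale; no optional sampling of the won values is needed.\<close>
lemma mgf_dev:
  "(\<integral>\<^sup>+\<omega>. exp (l * dev n \<omega> - l\<^sup>2 / 8 * real (wins n \<omega>)) \<partial>P) \<le> 1"
proof (induction n)
  case 0
  then show ?case by (simp add: dev_def win_count_def emeasure_space_1)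
next
  case (Suc n)
  let ?i = "Inl (Suc n) :: nat + nat"
  let ?x = "\<lambda>\<omega>. restrict (\<lambda>j. joint j \<omega>) (- {?i})"
  let ?N = "PiM (- {?i}) (\<lambda>_. borel :: real measure)"
  define G :: "(nat + nat \<Rightarrow> real) \<Rightarrow> real" where
    "G x = exp (l * ((\<Sum>s\<in>win_set \<gamma> (\<lambda>s. x (Inl s)) (\<lambda>s. x (Inr s)) n. x (Inl s))
        - v * real (win_count \<gamma> (\<lambda>s. x (Inl s)) (\<lambda>s. x (Inr s)) n))
        - l\<^sup>2 / 8 * real (win_count \<gamma> (\<lambda>s. x (Inl s)) (\<lambda>s. x (Inr s)) n))" for x
  define W where "W x \<longleftrightarrow> x (Inr (Suc n)) \<le> oucb_bid \<gamma> (\<lambda>s. x (Inl s)) (\<lambda>s. x (Inr s)) (Suc n)"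
    for x :: "nat + nat \<Rightarrow> real"
  define g where "g z = ennreal (G (fst z) *
      (if W (fst z) then exp (l * (snd z - v) - l\<^sup>2 / 8) else 1))" for z
  have i: "?i \<notin> Inl ` {1..n} \<union> Inr ` {1..n}" by auto
  note past = past_restrict[OF i]
  have "(\<lambda>x. \<Sum>s\<in>win_set \<gamma> (\<lambda>s. x (Inl s)) (\<lambda>s. x (Inr s)) n. x (Inl s)) \<in> borel_measurable ?N"
    "(\<lambda>x. real (win_count \<gamma> (\<lambda>s. x (Inl s)) (\<lambda>s. x (Inr s)) n)) \<in> borel_measurable ?N"
    by (intro measurable_win_sum measurable_win_count measurable_component_PiM)+
  note [measurable] = this
  have [measurable]: "G \<in> borel_measurable ?N"
    unfolding G_def by measurable
  have [measurable]: "Measurable.pred ?N W"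
    unfolding W_def pred_def
    by (intro borel_measurable_le measurable_oucb_bid measurable_component_PiM)
  have g [measurable]: "g \<in> borel_measurable (?N \<Otimes>\<^sub>M borel)"
    unfolding g_def by measurable
  have G: "G (?x \<omega>) = exp (l * dev n \<omega> - l\<^sup>2 / 8 * real (wins n \<omega>))" for \<omega>
  proof -
    have "(\<Sum>s\<in>won n \<omega>. ?x \<omega> (Inl s)) = (\<Sum>s\<in>won n \<omega>. V s \<omega>)"
      using won_subset past(5) by (intro sum.cong) auto
    then show ?thesis unfolding G_def past dev_def by simp
  qed
  \<comment> \<open>Only the value of round \<open>n + 1\<close> has been removed; its competing bid
    \<open>Inr (Suc n)\<close> survives the restriction, so winning is decided before the value is
    integrated out.\<close>
  have W: "W (?x \<omega>) \<longleftrightarrow> Mc (Suc n) \<omega> \<le> bid (Suc n) \<omega>" for \<omega>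
    unfolding W_def past by simp
  have step: "ennreal (exp (l * dev (Suc n) \<omega> - l\<^sup>2 / 8 * real (wins (Suc n) \<omega>))) = g (?x \<omega>, joint ?i \<omega>)"
    for \<omega>
  proof (cases "Mc (Suc n) \<omega> \<le> bid (Suc n) \<omega>")
    case True
    have "l * dev (Suc n) \<omega> - l\<^sup>2 / 8 * real (wins (Suc n) \<omega>) =
        (l * dev n \<omega> - l\<^sup>2 / 8 * real (wins n \<omega>)) + (l * (V (Suc n) \<omega> - v) - l\<^sup>2 / 8)"
      using True by (simp add: dev_def win_set_Suc win_count_Suc algebra_simps)
    then show ?thesis using True by (simp add: g_def G W exp_add)
  next
    case False
    then show ?thesis by (simp add: g_def G W dev_def win_set_Suc win_count_Suc)
  qed
  have "(\<integral>\<^sup>+\<omega>. exp (l * dev (Suc n) \<omega> - l\<^sup>2 / 8 * real (wins (Suc n) \<omega>)) \<partial>P)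
      = (\<integral>\<^sup>+\<omega>. g (?x \<omega>, joint ?i \<omega>) \<partial>P)"
    by (simp only: step)
  also have "\<dots> = (\<integral>\<^sup>+\<omega>. (\<integral>\<^sup>+\<omega>'. g (?x \<omega>, joint ?i \<omega>') \<partial>P) \<partial>P)"
    by (rule indep_vars_nn_integral_coordinate[OF indep g])
  also have "\<dots> \<le> (\<integral>\<^sup>+\<omega>. ennreal (G (?x \<omega>)) \<partial>P)"
  proof (rule nn_integral_mono)
    fix \<omega>
    have G0: "0 \<le> G (?x \<omega>)" by (simp add: G)
    show "(\<integral>\<^sup>+\<omega>'. g (?x \<omega>, joint ?i \<omega>') \<partial>P) \<le> ennreal (G (?x \<omega>))"
    proof (cases "W (?x \<omega>)")
      case True
      have "(\<integral>\<^sup>+\<omega>'. g (?x \<omega>, joint ?i \<omega>') \<partial>P)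
          = (\<integral>\<^sup>+\<omega>'. ennreal (G (?x \<omega>) * exp (- l\<^sup>2 / 8)) * ennreal (exp (l * (V (Suc n) \<omega>' - v))) \<partial>P)"
        using True G0 by (intro nn_integral_cong)
          (simp add: g_def ennreal_mult[symmetric] mult.assoc exp_add[symmetric])
      also have "\<dots> = ennreal (G (?x \<omega>) * exp (- l\<^sup>2 / 8)) * (\<integral>\<^sup>+\<omega>'. exp (l * (V (Suc n) \<omega>' - v)) \<partial>P)"
        by (intro nn_integral_cmult) measurable
      also have "\<dots> \<le> ennreal (G (?x \<omega>) * exp (- l\<^sup>2 / 8)) * ennreal (exp (l\<^sup>2 / 8))"
        using mgf_unit_interval[of "V (Suc n)" l] V_range
        by (intro mult_left_mono) (auto simp: V_mean)
      also have "\<dots> = ennreal (G (?x \<omega>))"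
        using G0 by (simp add: ennreal_mult[symmetric] exp_minus)
      finally show ?thesis .
    qed (simp add: g_def emeasure_space_1)
  qed
  also have "\<dots> = (\<integral>\<^sup>+\<omega>. exp (l * dev n \<omega> - l\<^sup>2 / 8 * real (wins n \<omega>)) \<partial>P)"
    by (simp only: G)
  also have "\<dots> \<le> 1" by (rule Suc.IH)
  finally show ?case .
qed

lemma prob_dev:
  "prob {\<omega> \<in> space P. l * dev n \<omega> - l\<^sup>2 / 8 * real (wins n \<omega>) \<ge> x} \<le> exp (- x)"
proof -
  let ?Y = "\<lambda>\<omega>. l * dev n \<omega> - l\<^sup>2 / 8 * real (wins n \<omega>)"
  let ?A = "{\<omega> \<in> space P. ?Y \<omega> \<ge> x}"
  have "emeasure P ?A = (\<integral>\<^sup>+\<omega>. indicator ?A \<omega> \<partial>P)" by simp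
  also have "\<dots> \<le> (\<integral>\<^sup>+\<omega>. ennreal (exp (- x)) * ennreal (exp (?Y \<omega>)) \<partial>P)"
  proof (rule nn_integral_mono)
    fix \<omega>
    have "1 \<le> exp (- x + ?Y \<omega>)" if "\<omega> \<in> ?A" using that by simp
    then show "indicator ?A \<omega> \<le> ennreal (exp (- x)) * ennreal (exp (?Y \<omega>))"
      unfolding exp_add by (cases "\<omega> \<in> ?A") (auto simp: ennreal_mult[symmetric])
  qed
  also have "\<dots> = ennreal (exp (- x)) * (\<integral>\<^sup>+\<omega>. exp (?Y \<omega>) \<partial>P)"
    by (intro nn_integral_cmult) measurable
  also have "\<dots> \<le> ennreal (exp (- x)) * 1"
    by (intro mult_left_mono mgf_dev) simp
  finally show ?thesis by (simp add: emeasure_eq_measure)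
qed

text \<open>Radius and bid of round \<open>n + 1\<close> are functions of the first \<open>n\<close>
  rounds, so integrating out the single coordinate \<open>Mc (Suc n)\<close> turns the indicator of
  a win into \<open>F\<close> at the bid.\<close>

lemma nn_integral_win:
  "(\<integral>\<^sup>+\<omega>. ennreal (rad n \<omega> * (if Mc (Suc n) \<omega> \<le> bid (Suc n) \<omega> then 1 else 0)) \<partial>P)
   = (\<integral>\<^sup>+\<omega>. ennreal (rad n \<omega> * F (bid (Suc n) \<omega>)) \<partial>P)"
proof -
  let ?i = "Inr (Suc n) :: nat + nat"
  let ?x = "\<lambda>\<omega>. restrict (\<lambda>j. joint j \<omega>) (- {?i})"
  let ?N = "PiM (- {?i}) (\<lambda>_. borel :: real measure)"
  define r where "r x = radius \<gamma> (\<lambda>s. x (Inl s)) (\<lambda>s. x (Inr s)) n" for x :: "nat + nat \<Rightarrow> real"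
  define b where "b x = oucb_bid \<gamma> (\<lambda>s. x (Inl s)) (\<lambda>s. x (Inr s)) (Suc n)" for x :: "nat + nat \<Rightarrow> real"
  define g where "g z = ennreal (r (fst z) * (if snd z \<le> b (fst z) then 1 else 0))" for z
  have i: "?i \<notin> Inl ` {1..n} \<union> Inr ` {1..n}" by auto
  note past = past_restrict[OF i]
  have [measurable]: "r \<in> borel_measurable ?N" "b \<in> borel_measurable ?N"
    unfolding r_def b_def by (intro measurable_radius measurable_oucb_bid measurable_component_PiM)+
  have g: "g \<in> borel_measurable (?N \<Otimes>\<^sub>M borel)"
    unfolding g_def by measurable
  have rb: "r (?x \<omega>) = rad n \<omega>" "b (?x \<omega>) = bid (Suc n) \<omega>" for \<omega>
    unfolding r_def b_def past by simp_all
  have "(\<integral>\<^sup>+\<omega>. ennreal (rad n \<omega> * (if Mc (Suc n) \<omega> \<le> bid (Suc n) \<omega> then 1 else 0)) \<partial>P)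
      = (\<integral>\<^sup>+\<omega>. g (?x \<omega>, joint ?i \<omega>) \<partial>P)"
    unfolding g_def by (simp add: rb cong: if_cong)
  also have "\<dots> = (\<integral>\<^sup>+\<omega>. (\<integral>\<^sup>+\<omega>'. g (?x \<omega>, joint ?i \<omega>') \<partial>P) \<partial>P)"
    by (rule indep_vars_nn_integral_coordinate[OF indep g])
  also have "\<dots> = (\<integral>\<^sup>+\<omega>. ennreal (rad n \<omega> * F (bid (Suc n) \<omega>)) \<partial>P)"
  proof (rule nn_integral_cong)
    fix \<omega>
    have r0: "rad n \<omega> \<ge> 0" using \<gamma> by (intro radius_nonneg) simp
    let ?A = "{\<omega>' \<in> space P. Mc (Suc n) \<omega>' \<le> bid (Suc n) \<omega>}"
    have "(\<integral>\<^sup>+\<omega>'. g (?x \<omega>, joint ?i \<omega>') \<partial>P) = (\<integral>\<^sup>+\<omega>'. ennreal (rad n \<omega>) * indicator ?A \<omega>' \<partial>P)"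
      unfolding g_def fst_conv snd_conv rb by (intro nn_integral_cong) (auto simp: indicator_def)
    also have "\<dots> = ennreal (rad n \<omega>) * emeasure P ?A"
      by (intro nn_integral_cmult_indicator) measurable
    also have "\<dots> = ennreal (rad n \<omega> * F (bid (Suc n) \<omega>))"
      using r0 by (simp add: emeasure_eq_measure F_eq ennreal_mult F_bounds)
    finally show "(\<integral>\<^sup>+\<omega>'. g (?x \<omega>, joint ?i \<omega>') \<partial>P) = ennreal (rad n \<omega> * F (bid (Suc n) \<omega>))" .
  qed
  finally show ?thesis .
qed

end

section \<open>Deviation inequalities\<close>

text \<open>Peeling: for fixed \<open>l\<close> the exponent below is close to its maximum \<open>2 * x\<close> over \<open>l\<close> as long as
  \<open>sqrt N\<close> stays in one cell of the geometric grid of ratio \<open>1 / r\<close>.\<close>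
lemma peeling:
  fixes N S x r n :: real
  assumes N: "1 \<le> N" "N \<le> n" and r: "0 < r" "r < 1" and x: "0 \<le> x"
    and K: "n \<le> (1 / r) ^ K" and S: "sqrt (N * x) \<le> S"
  shows "\<exists>k\<le>K. 2 * x * (r * (2 - r)) \<le>
    (4 * sqrt x * r ^ k) * S - (4 * sqrt x * r ^ k)\<^sup>2 / 8 * N"
proof -
  define k where "k = (LEAST k. sqrt N \<le> (1 / r) ^ k)"
  have "sqrt N \<le> N" using N by (intro real_le_lsqrt) (auto simp: power2_eq_square)
  then have ex: "sqrt N \<le> (1 / r) ^ K" using N K by linarith
  have k1: "sqrt N \<le> (1 / r) ^ k" unfolding k_def using ex by (rule LeastI)
  have kK: "k \<le> K" unfolding k_def using ex by (rule Least_le)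
  \<comment> \<open>In terms of \<open>\<rho>\<close>, which lies between \<open>r\<close> and 1,
    the exponent is at least \<open>2 * x * (2 * \<rho> - \<rho> ^ 2)\<close>. This increases in
    \<open>\<rho>\<close> up to its peak at 1, so its least value is the one at
    \<open>r\<close>.\<close>
  define \<rho> where "\<rho> = sqrt N * r ^ k"
  have \<rho>1: "\<rho> \<le> 1"
    using k1 r by (simp add: \<rho>_def power_divide field_simps)
  have \<rho>r: "r \<le> \<rho>"
  proof (cases k)
    case 0
    have "1 \<le> sqrt N" using N by simp
    then have "r \<le> sqrt N" using r by linarith
    then show ?thesis using 0 by (simp add: \<rho>_def)
  next
    case (Suc j)
    have "\<not> sqrt N \<le> (1 / r) ^ j"
      using not_less_Least[of j "\<lambda>k. sqrt N \<le> (1 / r) ^ k"] Suc by (simp add: k_def)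
    then have "1 \<le> sqrt N * r ^ j" using r by (simp add: power_divide field_simps)
    then have "r * 1 \<le> r * (sqrt N * r ^ j)" using r by (intro mult_left_mono) auto
    then show ?thesis using Suc by (simp add: \<rho>_def mult_ac)
  qed
  have "0 \<le> (\<rho> - r) * (2 - \<rho> - r)" using \<rho>1 \<rho>r r by (intro mult_nonneg_nonneg) auto
  then have "r * (2 - r) \<le> 2 * \<rho> - \<rho>\<^sup>2" by (simp add: algebra_simps power2_eq_square)
  then have "2 * x * (r * (2 - r)) \<le> 2 * x * (2 * \<rho> - \<rho>\<^sup>2)" using x by (intro mult_left_mono) auto
  also have "\<dots> = 4 * x * \<rho> - 2 * x * \<rho>\<^sup>2" by (simp add: algebra_simps)
  also have "4 * x * \<rho> = (4 * sqrt x * r ^ k) * sqrt (N * x)"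
    using x by (simp add: \<rho>_def real_sqrt_mult)
  also have "\<dots> \<le> (4 * sqrt x * r ^ k) * S"
    using x r S by (intro mult_left_mono) auto
  also have "2 * x * \<rho>\<^sup>2 = (4 * sqrt x * r ^ k)\<^sup>2 / 8 * N"
    using x N by (simp add: \<rho>_def power_mult_distrib)
  finally show ?thesis using kK by auto
qed

text \<open>Taylor's formula with remainder factor at most \<open>3 / 6\<close>. Only the
  coefficient of the square has to be exact, since it decides the leading constant of the
  exponent.\<close>

lemma exp_le_third_order:
  fixes x :: real
  assumes "\<bar>x\<bar> \<le> 1"
  shows "exp x \<le> 1 + x + x\<^sup>2 / 2 + \<bar>x\<bar> ^ 3"
proof -
  obtain t where t: "\<bar>t\<bar> \<le> \<bar>x\<bar>" "exp x = (\<Sum>m<3. x ^ m / fact m) + exp t / fact 3 * x ^ 3"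
    using Maclaurin_exp_le[of x 3] by blast
  have "exp t \<le> exp 1" using t assms by simp
  also have "\<dots> \<le> 3" by (rule exp_le)
  finally have "exp t / fact 3 * \<bar>x\<bar> ^ 3 \<le> 1 * \<bar>x\<bar> ^ 3"
    by (intro mult_right_mono) (auto simp: fact_numeral)
  moreover have "exp t / fact 3 * x ^ 3 \<le> exp t / fact 3 * \<bar>x\<bar> ^ 3"
    by (intro mult_left_mono) (auto simp: power_abs[symmetric])
  moreover have "(\<Sum>m<3. x ^ m / fact m) = 1 + x + x\<^sup>2 / 2"
    by (simp add: numeral_3_eq_3 power2_eq_square)
  ultimately show ?thesis using t(2) by linarith
qed

text \<open>In the worst case \<open>q = 2 / 3\<close> the bound \<open>6 * q + 18 * q * (1 - q) \<le> 8\<close> is sharp, which is where the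
  choice of the exponential parameter \<open>6 * \<delta>\<close> comes from.\<close>
lemma exponent_bound:
  fixes a d p q \<delta> :: real
  assumes nonneg: "0 \<le> a" "0 \<le> d" "0 \<le> p" "0 \<le> q" and sums: "a + d \<le> 1" "p + q \<le> 1"
    and opt: "a * p \<le> d * q" and \<delta>: "0 \<le> \<delta>" "\<delta> \<le> 1 / 6"
  shows "p * (6 * \<delta> * a + (6 * \<delta> * a)\<^sup>2 / 2 + (6 * \<delta>) ^ 3)
       + q * (- (6 * \<delta> * (d - \<delta>)) + (6 * \<delta> * (d - \<delta>))\<^sup>2 / 2 + (6 * \<delta>) ^ 3)
       \<le> 8 * \<delta>\<^sup>2 + 234 * \<delta> ^ 3"
proof -
  \<comment> \<open>\<open>u\<close> is the slack in the optimality condition. It enters the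
    first-order term as \<open>- 6 * \<delta> * u\<close>, and this absorbs the \<open>u\<close>
    that appears at second order.\<close>
  define u where "u = d * q - a * p"
  have u: "0 \<le> u" using opt by (simp add: u_def)
  have "a * (1 - q - p) \<ge> 0" using nonneg sums by simp
  moreover have "a * (1 - q) \<le> (1 - d) * (1 - q)"
    using sums nonneg by (intro mult_right_mono) auto
  ultimately have "d \<le> u + 1 - q" by (simp add: u_def algebra_simps)
  then have "d * q \<le> (u + 1 - q) * q" using nonneg by (intro mult_right_mono) auto
  moreover have "u * q \<le> u * 1" using u nonneg sums by (intro mult_left_mono) auto
  ultimately have dq: "d * q \<le> q * (1 - q) + u" by (simp add: algebra_simps)
  have "p * a\<^sup>2 + q * d\<^sup>2 = (d * q) * (a + d) - a * u"
    by (simp add: u_def algebra_simps power2_eq_square)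
  also have "\<dots> \<le> (d * q) * 1 - 0"
    using nonneg sums u by (intro diff_mono mult_left_mono) auto
  finally have second: "p * a\<^sup>2 + q * d\<^sup>2 \<le> q * (1 - q) + u" using dq by simp
  have "(d - \<delta>)\<^sup>2 \<le> d\<^sup>2 + \<delta>\<^sup>2" using nonneg \<delta> by (simp add: power2_eq_square algebra_simps)
  then have "q * (d - \<delta>)\<^sup>2 \<le> q * (d\<^sup>2 + \<delta>\<^sup>2)" using nonneg by (intro mult_left_mono) auto
  also have "\<dots> \<le> q * d\<^sup>2 + \<delta>\<^sup>2"
    using nonneg sums mult_right_mono[of q 1 "\<delta>\<^sup>2"] by (simp add: algebra_simps)
  finally have "p * a\<^sup>2 + q * (d - \<delta>)\<^sup>2 \<le> q * (1 - q) + u + \<delta>\<^sup>2" using second by simp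
  then have "18 * \<delta>\<^sup>2 * (p * a\<^sup>2 + q * (d - \<delta>)\<^sup>2) \<le> 18 * \<delta>\<^sup>2 * (q * (1 - q) + u + \<delta>\<^sup>2)"
    by (intro mult_left_mono) auto
  moreover have "(p + q) * (6 * \<delta>) ^ 3 \<le> 1 * (6 * \<delta>) ^ 3"
    using sums \<delta> by (intro mult_right_mono) auto
  moreover have "p * (6 * \<delta> * a + (6 * \<delta> * a)\<^sup>2 / 2 + (6 * \<delta>) ^ 3)
       + q * (- (6 * \<delta> * (d - \<delta>)) + (6 * \<delta> * (d - \<delta>))\<^sup>2 / 2 + (6 * \<delta>) ^ 3)
     = 6 * \<delta>\<^sup>2 * q - 6 * \<delta> * u + 18 * \<delta>\<^sup>2 * (p * a\<^sup>2 + q * (d - \<delta>)\<^sup>2) + (p + q) * (6 * \<delta>) ^ 3"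
  proof -
    have "(6 * \<delta> * z)\<^sup>2 / 2 = 18 * \<delta>\<^sup>2 * z\<^sup>2" for z by (simp add: power_mult_distrib)
    then show ?thesis unfolding u_def by (simp only:) (simp add: algebra_simps power2_eq_square)
  qed
  moreover have "6 * \<delta>\<^sup>2 * q + 18 * \<delta>\<^sup>2 * (q * (1 - q)) \<le> 8 * \<delta>\<^sup>2"
  proof -
    have "0 \<le> (3 * q - 2)\<^sup>2" by simp
    then have "6 * q + 18 * (q * (1 - q)) \<le> 8" by (simp add: power2_eq_square algebra_simps)
    then have "\<delta>\<^sup>2 * (6 * q + 18 * (q * (1 - q))) \<le> \<delta>\<^sup>2 * 8" by (intro mult_left_mono) auto
    then show ?thesis by (simp add: algebra_simps)
  qed
  moreover have "18 * \<delta>\<^sup>2 * u \<le> 6 * \<delta> * u"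
  proof -
    have "(6 * \<delta> * u) * (3 * \<delta>) \<le> (6 * \<delta> * u) * 1"
      using \<delta> u by (intro mult_left_mono) auto
    then show ?thesis by (simp add: power2_eq_square algebra_simps)
  qed
  moreover have "18 * \<delta>\<^sup>2 * \<delta>\<^sup>2 \<le> 18 * \<delta> ^ 3"
  proof -
    have "18 * \<delta> ^ 3 * \<delta> \<le> 18 * \<delta> ^ 3 * 1" using \<delta> by (intro mult_left_mono) auto
    then show ?thesis by (simp add: power2_eq_square power3_eq_cube)
  qed
  moreover have "18 * \<delta>\<^sup>2 * (q * (1 - q) + u + \<delta>\<^sup>2) =
      18 * \<delta>\<^sup>2 * (q * (1 - q)) + 18 * \<delta>\<^sup>2 * u + 18 * \<delta>\<^sup>2 * \<delta>\<^sup>2"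
    by (simp add: algebra_simps)
  \<comment> \<open>The cubic constant 234 is this 216 plus the 18 from the preceding bound on the
    fourth-order term.\<close>
  moreover have "(6 * \<delta>) ^ 3 = 216 * \<delta> ^ 3" by (simp add: power_mult_distrib)
  ultimately show ?thesis by linarith
qed

context first_price_auction
begin

text \<open>The least value \<open>radius\<close> can take after \<open>n\<close> rounds, reached if
  all of them are won; also the natural scale of the empirical distribution, which sees every
  round.\<close>

definition width :: "nat \<Rightarrow> real" where
  "width n = sqrt (\<gamma> * ln (real n) / (2 * real n))"

lemma width_sq: "n \<ge> 1 \<Longrightarrow> real n * (width n)\<^sup>2 = \<gamma> * ln (real n) / 2"
  using \<gamma> by (simp add: width_def)

lemma width_nonneg: "width n \<ge> 0"
  using \<gamma> by (cases "n = 0") (auto simp: width_def)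

lemma ecdf_sum: "n \<ge> 1 \<Longrightarrow> real n * ecdf ms n b = (\<Sum>s=1..n. indicator {..b} (ms s))"
  unfolding ecdf_def by (subst real_card_filter) (auto intro!: sum.cong)

lemma ecdf_less_sum: "n \<ge> 1 \<Longrightarrow> real n * ecdf_less ms n b = (\<Sum>s=1..n. indicator {..<b} (ms s))"
  unfolding ecdf_less_def by (subst real_card_filter) (auto intro!: sum.cong)

text \<open>Hoeffding's inequality for either sign \<open>\<sigma>\<close>; the tilt
  \<open>l = 4 * y\<close> minimises \<open>l ^ 2 / 8 - l * y\<close>.\<close>

lemma prob_indicator_dev:
  assumes [measurable]: "A \<in> sets borel" and \<sigma>: "\<sigma> = 1 \<or> \<sigma> = -1" and y: "y \<ge> 0"
  shows "prob {\<omega> \<in> space P. (\<Sum>s=1..n. \<sigma> * (indicator A (Mc s \<omega>) - prob {\<omega> \<in> space P. Mc 0 \<omega> \<in> A}))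
      \<ge> real n * y} \<le> exp (- 2 * real n * y\<^sup>2)"
proof -
  define p where "p = prob {\<omega> \<in> space P. Mc 0 \<omega> \<in> A}"
  let ?Y = "\<lambda>\<omega>. indicator A (Mc 0 \<omega>) :: real"
  have "expectation ?Y = expectation (indicator {\<omega> \<in> space P. Mc 0 \<omega> \<in> A})"
    by (intro Bochner_Integration.integral_cong) (auto simp: indicator_def)
  then have p: "expectation ?Y = p" by (simp add: p_def)
  have \<sigma>2: "(4 * y * \<sigma>)\<^sup>2 / 8 = 2 * y\<^sup>2" using \<sigma> by (auto simp: power_mult_distrib)
  have "?Y \<omega> \<in> {0..1}" for \<omega> by (auto simp: indicator_def)
  then have mgf: "(\<integral>\<^sup>+\<omega>. exp (4 * y * \<sigma> * (indicator A (Mc 0 \<omega>) - p)) \<partial>P) \<le> ennreal (exp (2 * y\<^sup>2))"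
    using mgf_unit_interval[of ?Y "4 * y * \<sigma>"] unfolding p \<sigma>2 by simp
  have "prob {\<omega> \<in> space P. (\<Sum>s=1..n. \<sigma> * (indicator A (Mc s \<omega>) - p)) \<ge> real n * y} \<le>
      prob {\<omega> \<in> space P. (\<Sum>s=1..n. 4 * y * \<sigma> * (indicator A (Mc s \<omega>) - p)) \<ge> 4 * y * (real n * y)}"
  proof (rule finite_measure_mono, safe)
    fix \<omega> assume "real n * y \<le> (\<Sum>s=1..n. \<sigma> * (indicator A (Mc s \<omega>) - p))"
    then have "4 * y * (real n * y) \<le> 4 * y * (\<Sum>s=1..n. \<sigma> * (indicator A (Mc s \<omega>) - p))"
      using y by (intro mult_left_mono) auto
    then show "4 * y * (real n * y) \<le> (\<Sum>s=1..n. 4 * y * \<sigma> * (indicator A (Mc s \<omega>) - p))"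
      by (simp add: sum_distrib_left mult.assoc)
  qed measurable
  also have "\<dots> \<le> exp (real n * (2 * y\<^sup>2) - 4 * y * (real n * y))"
    by (rule chernoff_iid[OF Mc_indep M_id _ mgf]) measurable
  also have "real n * (2 * y\<^sup>2) - 4 * y * (real n * y) = - 2 * real n * y\<^sup>2"
    by (simp add: power2_eq_square)
  finally show ?thesis by (simp add: p_def)
qed

lemma prob_ecdf_dev:
  assumes "y \<ge> 0" "n \<ge> 1"
  shows "prob {\<omega> \<in> space P. F b - ecdf (\<lambda>s. Mc s \<omega>) n b \<ge> y} \<le> exp (- 2 * real n * y\<^sup>2)"
proof -
  have "F b - ecdf (\<lambda>s. Mc s \<omega>) n b \<ge> y \<longleftrightarrow>
      (\<Sum>s=1..n. -1 * (indicator {..b} (Mc s \<omega>) - prob {\<omega> \<in> space P. Mc 0 \<omega> \<in> {..b}})) \<ge> real n * y" for \<omega>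
  proof -
    have "(\<Sum>s=1..n. -1 * (indicator {..b} (Mc s \<omega>) - prob {\<omega> \<in> space P. Mc 0 \<omega> \<in> {..b}}))
        = real n * (F b - ecdf (\<lambda>s. Mc s \<omega>) n b)"
      unfolding right_diff_distrib ecdf_sum[OF assms(2)]
      by (simp add: sum_subtractf sum_negf F_cdf)
    then show ?thesis using assms(2) by simp
  qed
  then show ?thesis
    using prob_indicator_dev[of "{..b}" "-1" y n] assms by simp
qed

text \<open>The difference is the empirical frequency of one open interval, so a single application
  of Hoeffding suffices and the errors at the two ends are not added.\<close>

lemma prob_ecdf_gap:
  assumes "y \<ge> 0" "n \<ge> 1" "b < g"
  shows "prob {\<omega> \<in> space P. (ecdf_less (\<lambda>s. Mc s \<omega>) n g - ecdf (\<lambda>s. Mc s \<omega>) n b)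
      - (prob {\<omega> \<in> space P. Mc 0 \<omega> < g} - F b) \<ge> y} \<le> exp (- 2 * real n * y\<^sup>2)"
proof -
  have split: "{\<omega> \<in> space P. Mc 0 \<omega> \<in> {b<..<g}} = {\<omega> \<in> space P. Mc 0 \<omega> < g} - {\<omega> \<in> space P. Mc 0 \<omega> \<le> b}"
    by auto
  have p: "prob {\<omega> \<in> space P. Mc 0 \<omega> \<in> {b<..<g}} = prob {\<omega> \<in> space P. Mc 0 \<omega> < g} - F b"
    unfolding F_cdf split using assms(3) by (intro finite_measure_Diff) auto
  have ind: "indicator {b<..<g} m = indicator {..<g} m - (indicator {..b} m :: real)" for m
    using assms(3) by (auto simp: indicator_def)
  have "(ecdf_less (\<lambda>s. Mc s \<omega>) n g - ecdf (\<lambda>s. Mc s \<omega>) n b)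
      - (prob {\<omega> \<in> space P. Mc 0 \<omega> < g} - F b) \<ge> y \<longleftrightarrow>
      (\<Sum>s=1..n. 1 * (indicator {b<..<g} (Mc s \<omega>) - prob {\<omega> \<in> space P. Mc 0 \<omega> \<in> {b<..<g}})) \<ge> real n * y" for \<omega>
  proof -
    have "(\<Sum>s=1..n. 1 * (indicator {b<..<g} (Mc s \<omega>) - prob {\<omega> \<in> space P. Mc 0 \<omega> \<in> {b<..<g}}))
        = real n * ((ecdf_less (\<lambda>s. Mc s \<omega>) n g - ecdf (\<lambda>s. Mc s \<omega>) n b)
      - (prob {\<omega> \<in> space P. Mc 0 \<omega> < g} - F b))"
      unfolding right_diff_distrib ecdf_sum[OF assms(2)] ecdf_less_sum[OF assms(2)] p ind
      by (simp add: sum_subtractf right_diff_distrib)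
    then show ?thesis using assms(2) by simp
  qed
  then show ?thesis
    using prob_indicator_dev[of "{b<..<g}" 1 y n, OF _ _ assms(1)]
    by (simp only: borel_open open_greaterThanLessThan simp_thms)
qed

text \<open>Lowering \<open>v\<close> by \<open>\<delta>\<close> models a pessimistic value
  estimate, the kind that favours the smaller bid \<open>g\<close>. The variable multiplied by
  \<open>6 * \<delta>\<close> takes three values: \<open>b - g\<close> below \<open>g\<close>,
  \<open>- (v - b - \<delta>)\<close> between \<open>g\<close> and \<open>b\<close>, and 0 above
  \<open>b\<close>. Optimality of \<open>b\<close> over \<open>g\<close> supplies the hypothesis
  \<open>a * p \<le> d * q\<close> of \<open>exponent_bound\<close>.\<close>

lemma mgf_utility_gap:
  assumes g: "0 \<le> g" "g \<le> b" "b \<le> v" and opt: "util v F g \<le> util v F b"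
    and \<delta>: "0 \<le> \<delta>" "\<delta> \<le> 1 / 6"
  shows "(\<integral>\<^sup>+\<omega>. exp (6 * \<delta> * ((v - g - \<delta>) * indicator {..<g} (Mc 0 \<omega>)
      - (v - b - \<delta>) * indicator {..b} (Mc 0 \<omega>))) \<partial>P) \<le> ennreal (exp (8 * \<delta>\<^sup>2 + 234 * \<delta> ^ 3))"
proof -
  define a where "a = b - g"
  define d where "d = v - b"
  define A1 where "A1 = {\<omega> \<in> space P. Mc 0 \<omega> < g}"
  define A2 where "A2 = {\<omega> \<in> space P. g \<le> Mc 0 \<omega> \<and> Mc 0 \<omega> \<le> b}"
  have [measurable]: "A1 \<in> sets P" "A2 \<in> sets P" by (simp_all add: A1_def A2_def)
  define c1 where "c1 = 6 * \<delta> * a + (6 * \<delta> * a)\<^sup>2 / 2 + (6 * \<delta>) ^ 3"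
  define c2 where "c2 = - (6 * \<delta> * (d - \<delta>)) + (6 * \<delta> * (d - \<delta>))\<^sup>2 / 2 + (6 * \<delta>) ^ 3"
  have ad: "0 \<le> a" "0 \<le> d" "a + d \<le> 1" using g v_bounds by (auto simp: a_def d_def)
  have \<delta>small: "\<bar>6 * \<delta> * z\<bar> \<le> 6 * \<delta>" "\<bar>6 * \<delta> * z\<bar> \<le> 1" if "\<bar>z\<bar> \<le> 1" for z
  proof -
    have "6 * \<delta> * \<bar>z\<bar> \<le> 6 * \<delta> * 1" using that \<delta> by (intro mult_left_mono) auto
    then show "\<bar>6 * \<delta> * z\<bar> \<le> 6 * \<delta>" "\<bar>6 * \<delta> * z\<bar> \<le> 1" using \<delta> by (auto simp: abs_mult)
  qed
  have third: "exp (6 * \<delta> * z) \<le> 1 + (6 * \<delta> * z + (6 * \<delta> * z)\<^sup>2 / 2 + (6 * \<delta>) ^ 3)"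
    if "\<bar>z\<bar> \<le> 1" for z
  proof -
    have "\<bar>6 * \<delta> * z\<bar> ^ 3 \<le> (6 * \<delta>) ^ 3" using \<delta>small(1)[OF that] by (intro power_mono) auto
    then show ?thesis using exp_le_third_order[OF \<delta>small(2)[OF that]] by linarith
  qed
  have pw: "exp (6 * \<delta> * ((v - g - \<delta>) * indicator {..<g} (Mc 0 \<omega>) - (v - b - \<delta>) * indicator {..b} (Mc 0 \<omega>)))
      \<le> 1 + c1 * indicator A1 \<omega> + c2 * indicator A2 \<omega>" if "\<omega> \<in> space P" for \<omega>
  proof -
    consider "Mc 0 \<omega> < g" | "g \<le> Mc 0 \<omega>" "Mc 0 \<omega> \<le> b" | "b < Mc 0 \<omega>" by linarith
    then show ?thesis
    proof cases
      case 1
      then show ?thesis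
        using third[of a] ad g that by (simp add: A1_def A2_def a_def c1_def)
    next
      case 2
      have "\<bar>- (d - \<delta>)\<bar> \<le> 1" using ad \<delta> by auto
      from third[OF this] have "exp (- (6 * \<delta> * (d - \<delta>))) \<le> 1 + c2"
        unfolding c2_def mult_minus_right power2_minus .
      moreover have "6 * \<delta> * ((v - g - \<delta>) * indicator {..<g} (Mc 0 \<omega>) - (v - b - \<delta>) * indicator {..b} (Mc 0 \<omega>))
          = - (6 * \<delta> * (d - \<delta>))"
        using 2 by (simp add: d_def algebra_simps)
      moreover have "indicator A1 \<omega> = (0::real)" "indicator A2 \<omega> = (1::real)"
        using 2 that by (auto simp: A1_def A2_def)
      ultimately show ?thesis
        by (simp only: mult_zero_right mult_1_right add_0_right)
    next
      case 3
      then show ?thesis using g that by (simp add: A1_def A2_def)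
    qed
  qed
  have ind_int: "integrable P (\<lambda>\<omega>. c * indicator A \<omega>)" if "A \<in> sets P" for A and c :: real
    using that by (intro integrable_mult_right integrable_real_indicator) (auto simp: less_top[symmetric])
  have int: "integrable P (\<lambda>\<omega>. 1 + c1 * indicator A1 \<omega> + c2 * indicator A2 \<omega>)"
    by (intro Bochner_Integration.integrable_add ind_int) auto
  have "(\<integral>\<^sup>+\<omega>. exp (6 * \<delta> * ((v - g - \<delta>) * indicator {..<g} (Mc 0 \<omega>)
      - (v - b - \<delta>) * indicator {..b} (Mc 0 \<omega>))) \<partial>P)
      \<le> (\<integral>\<^sup>+\<omega>. ennreal (1 + c1 * indicator A1 \<omega> + c2 * indicator A2 \<omega>) \<partial>P)"
    by (intro nn_integral_mono ennreal_leI pw)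
  also have "\<dots> = ennreal (expectation (\<lambda>\<omega>. 1 + c1 * indicator A1 \<omega> + c2 * indicator A2 \<omega>))"
  proof (rule nn_integral_eq_integral[OF int])
    show "AE \<omega> in P. 0 \<le> 1 + c1 * indicator A1 \<omega> + c2 * indicator A2 \<omega>"
    proof (rule AE_I2)
      fix \<omega> assume "\<omega> \<in> space P"
      from order_trans[OF _ pw[OF this]]
      show "0 \<le> 1 + c1 * indicator A1 \<omega> + c2 * indicator A2 \<omega>" by simp
    qed
  qed
  also have "expectation (\<lambda>\<omega>. 1 + c1 * indicator A1 \<omega> + c2 * indicator A2 \<omega>)
      = 1 + (prob A1 * c1 + prob A2 * c2)"
  proof -
    have "expectation (\<lambda>\<omega>. 1 + c1 * indicator A1 \<omega> + c2 * indicator A2 \<omega>)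
        = expectation (\<lambda>\<omega>. 1 + c1 * indicator A1 \<omega>) + expectation (\<lambda>\<omega>. c2 * indicator A2 \<omega>)"
      by (intro Bochner_Integration.integral_add Bochner_Integration.integrable_add ind_int) auto
    also have "expectation (\<lambda>\<omega>. 1 + c1 * indicator A1 \<omega>)
        = expectation (\<lambda>\<omega>. 1) + expectation (\<lambda>\<omega>. c1 * indicator A1 \<omega>)"
      by (intro Bochner_Integration.integral_add ind_int) auto
    finally show ?thesis by (simp add: prob_space)
  qed
  also have "1 + (prob A1 * c1 + prob A2 * c2) \<le> 1 + (8 * \<delta>\<^sup>2 + 234 * \<delta> ^ 3)"
  proof -
    have "A1 \<union> A2 = {\<omega> \<in> space P. Mc 0 \<omega> \<le> b}" "A1 \<inter> A2 = {}"
      using g by (auto simp: A1_def A2_def)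
    then have pq: "prob A1 + prob A2 = F b"
      unfolding F_cdf using finite_measure_Union[of A1 A2] by simp
    have "prob A1 \<le> F g" unfolding F_cdf A1_def by (intro finite_measure_mono) auto
    then have "(v - g) * prob A1 \<le> (v - g) * F g" using g by (intro mult_left_mono) auto
    also have "\<dots> \<le> (v - b) * (prob A1 + prob A2)" using opt by (simp add: util_def pq)
    finally have "a * prob A1 \<le> d * prob A2" by (simp add: a_def d_def algebra_simps)
    then have "prob A1 * c1 + prob A2 * c2 \<le> 8 * \<delta>\<^sup>2 + 234 * \<delta> ^ 3"
      unfolding c1_def c2_def using ad \<delta> pq F_bounds(2)[of b] by (intro exponent_bound) auto
    then show ?thesis by simp
  qed
  also have "1 + (8 * \<delta>\<^sup>2 + 234 * \<delta> ^ 3) \<le> exp (8 * \<delta>\<^sup>2 + 234 * \<delta> ^ 3)"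
    by (rule exp_ge_add_one_self)
  finally show ?thesis by (simp add: ennreal_leI)
qed

text \<open>The threshold contributes \<open>- 12 * n * \<delta> ^ 2\<close> and the moment
  \<open>8 * n * \<delta> ^ 2\<close>. The allowance \<open>2 / n\<close> pays for rounding to a
  grid and for the strict slack required by \<open>candidate_gt\<close>; it costs only
  \<open>12 * \<delta>\<close> in the exponent.\<close>

lemma prob_utility_gap:
  assumes n: "n \<ge> 1" and g: "0 \<le> g" "g \<le> b" "b \<le> v" and opt: "util v F g \<le> util v F b"
    and \<delta>: "0 < \<delta>" "\<delta> \<le> 1 / 6"
  shows "prob {\<omega> \<in> space P. (v - g - \<delta>) * ecdf_less (\<lambda>s. Mc s \<omega>) n g
      - (v - b - \<delta>) * ecdf (\<lambda>s. Mc s \<omega>) n b \<ge> 2 * \<delta> - 2 / real n}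
    \<le> exp (- 4 * (real n * \<delta>\<^sup>2) + 12 * \<delta> + 234 * (real n * \<delta> ^ 3))"
proof -
  define f where "f m = 6 * \<delta> * ((v - g - \<delta>) * indicator {..<g} m - (v - b - \<delta>) * indicator {..b} m)" for m :: real
  have [measurable]: "f \<in> borel_measurable borel" unfolding f_def by measurable
  have sum: "(\<Sum>s=1..n. f (Mc s \<omega>)) = 6 * \<delta> * real n * ((v - g - \<delta>) * ecdf_less (\<lambda>s. Mc s \<omega>) n g
      - (v - b - \<delta>) * ecdf (\<lambda>s. Mc s \<omega>) n b)" for \<omega>
  proof -
    have "(\<Sum>s=1..n. f (Mc s \<omega>)) = 6 * \<delta> * ((v - g - \<delta>) * (\<Sum>s=1..n. indicator {..<g} (Mc s \<omega>))
        - (v - b - \<delta>) * (\<Sum>s=1..n. indicator {..b} (Mc s \<omega>)))"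
      by (simp only: f_def sum_distrib_left[symmetric] sum_subtractf)
    then show ?thesis
      unfolding ecdf_sum[OF n, symmetric] ecdf_less_sum[OF n, symmetric] by (simp add: algebra_simps)
  qed
  have "prob {\<omega> \<in> space P. (v - g - \<delta>) * ecdf_less (\<lambda>s. Mc s \<omega>) n g
      - (v - b - \<delta>) * ecdf (\<lambda>s. Mc s \<omega>) n b \<ge> 2 * \<delta> - 2 / real n}
    = prob {\<omega> \<in> space P. (\<Sum>s=1..n. f (Mc s \<omega>)) \<ge> 6 * \<delta> * real n * (2 * \<delta> - 2 / real n)}"
    unfolding sum using n \<delta> by (simp add: mult_le_cancel_left_pos)
  also have "\<dots> \<le> exp (real n * (8 * \<delta>\<^sup>2 + 234 * \<delta> ^ 3) - 6 * \<delta> * real n * (2 * \<delta> - 2 / real n))"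
    using mgf_utility_gap[OF g opt, of \<delta>] \<delta>
    by (intro chernoff_iid[OF Mc_indep M_id]) (auto simp: f_def)
  also have "real n * (8 * \<delta>\<^sup>2 + 234 * \<delta> ^ 3) - 6 * \<delta> * real n * (2 * \<delta> - 2 / real n)
      = - 4 * (real n * \<delta>\<^sup>2) + 12 * \<delta> + 234 * (real n * \<delta> ^ 3)"
    using n by (simp add: field_simps power2_eq_square power3_eq_cube)
  finally show ?thesis .
qed

text \<open>\<open>F\<close> may jump over the level \<open>c\<close>, so \<open>g\<close> is the
  supremum of the bids with \<open>F\<close> at most \<open>c\<close>. Continuity from below bounds
  the mass strictly below \<open>g\<close>, although \<open>F g\<close> itself may exceed
  \<open>c\<close>. If no bid qualifies, \<open>g = 0\<close> works because no competing bid is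
  negative.\<close>

lemma quantile_grid_point:
  assumes "c \<ge> 0"
  shows "\<exists>g. prob {\<omega> \<in> space P. Mc 0 \<omega> < g} \<le> c \<and> (\<forall>b\<in>{0..1}. F b \<le> c \<longrightarrow> b \<le> g)"
proof (cases "\<exists>b\<in>{0..1}. F b \<le> c")
  case False
  have "{\<omega> \<in> space P. Mc 0 \<omega> < 0} = {}" using M_range[of _ 0] by force
  then have "prob {\<omega> \<in> space P. Mc 0 \<omega> < 0} \<le> c" using assms by (metis measure_empty)
  then show ?thesis using False by blast
next
  case True
  define Q where "Q = {b \<in> {0..1}. F b \<le> c}"
  define g where "g = Sup Q"
  have Q: "Q \<noteq> {}" "bdd_above Q" using True by (auto simp: Q_def intro: bdd_aboveI[of _ 1])
  have below: "F x \<le> c" if x: "x < g" for x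
  proof -
    obtain b where "b \<in> Q" "x < b" using less_cSupD[OF Q(1), of x] x by (auto simp: g_def)
    then show ?thesis using F_mono[of x b] by (auto simp: Q_def)
  qed
  let ?A = "\<lambda>k::nat. {\<omega> \<in> space P. Mc 0 \<omega> \<le> g - inverse (real (Suc k))}"
  have "incseq ?A"
  proof (intro incseq_SucI subsetI)
    fix k \<omega> assume "\<omega> \<in> ?A k"
    moreover have "inverse (real (Suc (Suc k))) \<le> inverse (real (Suc k))" by (intro le_imp_inverse_le) auto
    ultimately show "\<omega> \<in> ?A (Suc k)" unfolding mem_Collect_eq by linarith
  qed
  then have lim: "(\<lambda>k. prob (?A k)) \<longlonglongrightarrow> prob (\<Union>k. ?A k)"
    by (intro finite_Lim_measure_incseq) auto
  moreover have "(\<Union>k. ?A k) = {\<omega> \<in> space P. Mc 0 \<omega> < g}"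
  proof safe
    fix \<omega> k assume "Mc 0 \<omega> \<le> g - inverse (real (Suc k))"
    moreover have "inverse (real (Suc k)) > 0" by simp
    ultimately show "Mc 0 \<omega> < g" by linarith
  next
    fix \<omega> assume \<omega>: "\<omega> \<in> space P" "Mc 0 \<omega> < g"
    obtain k where "inverse (real (Suc k)) < g - Mc 0 \<omega>"
      using \<omega> reals_Archimedean[of "g - Mc 0 \<omega>"] by auto
    then show "\<omega> \<in> (\<Union>k. ?A k)" using \<omega> by (auto intro!: exI[of _ k] simp del: of_nat_Suc)
  qed
  moreover have "prob (?A k) \<le> c" for k
    using below[of "g - inverse (real (Suc k))"] by (simp add: F_cdf)
  ultimately have "prob {\<omega> \<in> space P. Mc 0 \<omega> < g} \<le> c"
    using LIMSEQ_le_const2[OF lim, of c] by auto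
  moreover have "\<forall>b\<in>{0..1}. F b \<le> c \<longrightarrow> b \<le> g"
    unfolding g_def using Q(2) by (auto simp: Q_def intro!: cSup_upper)
  ultimately show ?thesis by blast
qed

end

section \<open>Optimal bids\<close>

text \<open>The regret of one round on the good event. The factor \<open>FB / Fs\<close> is kept because a win has
  probability \<open>FB\<close>; it also leaves room for the crude deviation bound \<open>3 / 2 * \<delta>\<close>.\<close>
lemma round_regret_bound:
  fixes v hv x B \<epsilon> \<delta> \<eta> Fs fs FB fB :: real
  assumes v: "x \<le> v" "v \<le> 1" "0 \<le> x" and B: "x < B" "B \<le> hv + \<epsilon>"
    and hv: "\<bar>hv - v\<bar> \<le> \<epsilon>" and \<delta>: "0 < \<delta>" "\<delta> \<le> \<epsilon>" "\<delta> \<le> 1 / 12" "0 \<le> \<eta>" "\<eta> \<le> \<delta> / 8"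
    and F: "0 < Fs" "Fs \<le> 1" "Fs \<le> FB" "fs \<le> fB" "0 \<le> fs"
    and low: "Fs - fs \<le> 3 / 2 * \<delta>" and gap: "fB - fs \<le> FB - Fs + \<eta> + 3 / 2 * \<delta>"
    and opt: "(hv - x) * fs - 2 * \<epsilon> \<le> (hv - B) * fB"
  shows "(v - x) * Fs - (v - B) * FB \<le> 4 / Fs * (\<epsilon> * FB)"
proof -
  define q where "q = FB - Fs"
  have q: "0 \<le> q" using F by (simp add: q_def)
  have \<epsilon>: "0 < \<epsilon>" using \<delta> by simp
  have "(hv - v) * (fB - fs) \<le> \<epsilon> * (fB - fs)"
    using hv F by (intro mult_right_mono) auto
  then have emp: "(v - x) * fs - (v - B) * fB \<le> 2 * \<epsilon> + \<epsilon> * (fB - fs)"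
    using opt by (simp add: algebra_simps)
  have \<eta>\<delta>: "\<eta> + 3 / 2 * \<delta> \<le> 1 / 4" using \<delta> by linarith
  have main: "(v - x) * Fs - (v - B) * FB \<le> \<epsilon> * (4 + 4 * q)"
  proof (cases "B \<le> v")
    case True
    \<comment> \<open>The nonnegative weights \<open>B - x\<close> and \<open>v - B\<close> add up
      to \<open>v - x\<close>, at most 1, so the two deviations are averaged rather than
      added.\<close>
    have "(v - x) * (Fs - fs) + (v - B) * (fB - FB)
        = (B - x) * (Fs - fs) + (v - B) * ((Fs - fs) + (fB - FB))"
      by (simp add: algebra_simps)
    also have "\<dots> \<le> (B - x) * (\<eta> + 3 / 2 * \<delta>) + (v - B) * (\<eta> + 3 / 2 * \<delta>)"
      using True B low gap \<delta> by (intro add_mono[OF mult_left_mono mult_left_mono]) auto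
    also have "\<dots> = (v - x) * (\<eta> + 3 / 2 * \<delta>)"
      unfolding distrib_right[symmetric] by simp
    also have "\<dots> \<le> 1 * (\<eta> + 3 / 2 * \<delta>)"
      using v \<delta> by (intro mult_right_mono) auto
    finally have "(v - x) * (Fs - fs) + (v - B) * (fB - FB) \<le> \<eta> + 3 / 2 * \<delta>" by simp
    moreover have "\<epsilon> * (fB - fs) \<le> \<epsilon> * (q + 1 / 4)"
      using gap \<eta>\<delta> \<epsilon> by (intro mult_left_mono) (auto simp: q_def)
    ultimately have "(v - x) * Fs - (v - B) * FB \<le> 2 * \<epsilon> + \<epsilon> * (q + 1 / 4) + \<eta> + 3 / 2 * \<delta>"
      using emp by (simp add: algebra_simps)
    \<comment> \<open>The constants add up to \<open>2 + 1 / 4 + 1 / 8 + 3 / 2\<close>, which is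
      below 4.\<close>
    also have "\<dots> \<le> \<epsilon> * (4 + 4 * q)"
      using \<delta> mult_nonneg_nonneg[OF less_imp_le[OF \<epsilon>] q] by (simp add: algebra_simps)
    finally show ?thesis .
  next
    case False
    have y: "0 < B - v" "B - v \<le> 2 * \<epsilon>" using False B hv by auto
    have "(v - x) * (Fs - fs) \<le> (v - x) * (3 / 2 * \<delta>)" using v low by (intro mult_left_mono) auto
    also have "\<dots> \<le> 1 * (3 / 2 * \<delta>)" using v \<delta> by (intro mult_right_mono) auto
    finally have l: "(v - x) * (Fs - fs) \<le> 3 / 2 * \<delta>" by simp
    have "\<epsilon> * (fB - fs) + (B - v) * (FB - fB) \<le> \<epsilon> * (2 * q + 1 / 4)"
    proof (cases "fB \<le> FB")
      case True
      have "(B - v) * (FB - fB) \<le> 2 * \<epsilon> * (FB - fB)" using y True by (intro mult_right_mono) auto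
      \<comment> \<open>Since \<open>fs \<le> fB\<close>, the bracket is at most
        \<open>2 * q + 2 * (Fs - fs)\<close>, hence at most \<open>2 * q + 3 * \<delta>\<close>; the
        assumption \<open>\<delta> \<le> 1 / 12\<close> makes the last term at most
        \<open>1 / 4\<close>.\<close>
      moreover have "\<epsilon> * (2 * (FB - fB) + (fB - fs)) \<le> \<epsilon> * (2 * q + 1 / 4)"
        using low F \<delta> \<epsilon> by (intro mult_left_mono) (auto simp: q_def)
      ultimately show ?thesis by (simp add: algebra_simps)
    next
      case False
      then have "(B - v) * (FB - fB) \<le> 0" using y by (intro mult_nonneg_nonpos) auto
      moreover have "\<epsilon> * (fB - fs) \<le> \<epsilon> * (2 * q + 1 / 4)"
        using gap \<eta>\<delta> \<epsilon> F by (intro mult_left_mono) (auto simp: q_def)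
      ultimately show ?thesis by simp
    qed
    then have "(v - x) * Fs - (v - B) * FB \<le> 2 * \<epsilon> + \<epsilon> * (2 * q + 1 / 4) + 3 / 2 * \<delta>"
      using emp l by (simp add: algebra_simps)
    also have "\<dots> \<le> \<epsilon> * (4 + 4 * q)"
      using \<delta> mult_nonneg_nonneg[OF less_imp_le[OF \<epsilon>] q] by (simp add: algebra_simps)
    finally show ?thesis .
  qed
  also have "\<epsilon> * (4 + 4 * q) \<le> \<epsilon> * (4 * (FB / Fs))"
  proof (rule mult_left_mono)
    have "Fs * q \<le> 1 * q" using F q by (intro mult_right_mono) auto
    then show "4 + 4 * q \<le> 4 * (FB / Fs)"
      using F by (simp add: q_def field_simps)
  qed (use \<epsilon> in simp)
  finally show ?thesis by (simp add: mult_ac)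
qed

context first_price_auction
begin

abbreviation (input) bopt :: real where
  "bopt \<equiv> bstar v F"

lemma util_le_1: "b \<in> {0..1} \<Longrightarrow> util v F b \<le> 1"
proof -
  assume b: "b \<in> {0..1}"
  have "(v - b) * F b \<le> 1 * F b" using b v_bounds F_bounds by (intro mult_right_mono) auto
  then show ?thesis using F_bounds(2)[of b] by (simp add: util_def)
qed

lemma util_ge_neg1: "b \<in> {0..1} \<Longrightarrow> -1 \<le> util v F b"
proof -
  assume b: "b \<in> {0..1}"
  have "(-1) * F b \<le> (v - b) * F b" using b v_bounds F_bounds by (intro mult_right_mono) auto
  then show ?thesis using F_bounds(2)[of b] by (simp add: util_def)
qed

lemma bdd_util: "bdd_above (util v F ` {0..1})"
  using util_le_1 by (intro bdd_aboveI2[of _ _ 1]) auto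

lemma F_right_cont: "(F \<longlongrightarrow> F x) (at_right x)"
proof -
  interpret D: prob_space "distr P borel (Mc 0)" by (rule prob_space_distr) simp
  interpret finite_borel_measure "distr P borel (Mc 0)"
    by standard simp
  have "F = cdf (distr P borel (Mc 0))"
  proof
    fix b
    have "{\<omega> \<in> space P. Mc 0 \<omega> \<le> b} = Mc 0 -` {..b} \<inter> space P" by auto
    then show "F b = cdf (distr P borel (Mc 0)) b"
      by (simp add: F_cdf cdf_def measure_distr)
  qed
  then show ?thesis using cdf_is_right_cont[of x] by (simp add: continuous_within)
qed

text \<open>A maximising sequence converges along a subsequence to some \<open>l\<close>.
  Monotonicity replaces \<open>F\<close> along the sequence by \<open>F (l + e)\<close>, the
  positive part keeping the factor nonnegative, and right-continuity lets \<open>e\<close> tend to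
  0. If \<open>l\<close> exceeds \<open>v\<close>, the supremum is at most 0 and bid 0 attains
  it.\<close>

lemma util_attains_sup: "\<exists>b\<in>{0..1}. \<forall>b'\<in>{0..1}. util v F b' \<le> util v F b"
proof -
  define m where "m = (SUP b\<in>{0..1}. util v F b)"
  have le_m: "util v F b \<le> m" if "b \<in> {0..1}" for b
    unfolding m_def using that by (intro cSUP_upper bdd_util)
  have "\<exists>b\<in>{0..1}. m - inverse (real (Suc k)) < util v F b" for k
  proof -
    have "m - inverse (real (Suc k)) < (SUP b\<in>{0..1}. util v F b)"
      by (simp add: m_def)
    then show ?thesis by (subst (asm) less_cSUP_iff[OF _ bdd_util]) auto
  qed
  then obtain x where x: "\<And>k. x k \<in> {0..1}" "\<And>k. m - inverse (real (Suc k)) < util v F (x k)"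
    by metis
  obtain l r where l: "l \<in> {0..1}" and r: "strict_mono (r :: nat \<Rightarrow> nat)" and lim: "(x \<circ> r) \<longlonglongrightarrow> l"
    using compact_Icc[of "0::real" 1] x(1) unfolding compact_def by blast
  have step: "m \<le> max 0 (v - l) * F (l + e)" if e: "e > 0" for e
  proof (rule tendsto_le[OF trivial_limit_sequentially])
    show "(\<lambda>k. max 0 (v - x (r k)) * F (l + e)) \<longlonglongrightarrow> max 0 (v - l) * F (l + e)"
      using lim by (intro tendsto_intros) (simp add: comp_def)
    have "(\<lambda>k. m - inverse (real (Suc k))) \<longlonglongrightarrow> m - 0"
      by (intro tendsto_intros LIMSEQ_inverse_real_of_nat)
    then show "((\<lambda>k. m - inverse (real (Suc k))) \<circ> r) \<longlonglongrightarrow> m"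
      using LIMSEQ_subseq_LIMSEQ[OF _ r] by simp
    have "eventually (\<lambda>k. x (r k) < l + e) sequentially"
      using order_tendstoD(2)[OF lim, of "l + e"] e by (simp add: comp_def)
    then show "eventually (\<lambda>k. ((\<lambda>k. m - inverse (real (Suc k))) \<circ> r) k \<le> max 0 (v - x (r k)) * F (l + e)) sequentially"
    proof (rule eventually_mono)
      fix k assume k: "x (r k) < l + e"
      have "util v F (x (r k)) \<le> max 0 (v - x (r k)) * F (x (r k))"
        unfolding util_def using F_bounds by (intro mult_right_mono) auto
      also have "\<dots> \<le> max 0 (v - x (r k)) * F (l + e)"
        using k by (intro mult_left_mono F_mono) auto
      finally show "((\<lambda>k. m - inverse (real (Suc k))) \<circ> r) k \<le> max 0 (v - x (r k)) * F (l + e)"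
        using x(2)[of "r k"] by (simp add: comp_def)
    qed
  qed
  have "m \<le> max 0 (v - l) * F l"
  proof (rule tendsto_le[OF trivial_limit_at_right_real])
    show "((\<lambda>y. max 0 (v - l) * F y) \<longlongrightarrow> max 0 (v - l) * F l) (at_right l)"
      by (intro tendsto_intros F_right_cont)
    show "eventually (\<lambda>y. m \<le> max 0 (v - l) * F y) (at_right l)"
      using eventually_at_right_less[of l]
    proof (rule eventually_mono)
      fix y assume "l < y"
      then show "m \<le> max 0 (v - l) * F y" using step[of "y - l"] by simp
    qed
  qed simp
  then show ?thesis
  proof (cases "l \<le> v")
    case True
    with \<open>m \<le> max 0 (v - l) * F l\<close> have "m \<le> util v F l" by (simp add: util_def)
    then show ?thesis using l le_m by force
  next
    case False
    with \<open>m \<le> max 0 (v - l) * F l\<close> have "m \<le> 0" by simp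
    also have "0 \<le> util v F 0" using v_bounds F_bounds by (simp add: util_def)
    finally show ?thesis using le_m by (intro bexI[of _ 0]) force+
  qed
qed

lemma bstar_approx:
  assumes "x < bopt"
  obtains a where "a \<in> {0..1}" "x < a" "a \<le> bopt" "\<forall>b\<in>{0..1}. util v F b \<le> util v F a"
proof -
  let ?A = "{b \<in> {0..1}. \<forall>b'\<in>{0..1}. util v F b' \<le> util v F b}"
  have A: "?A \<noteq> {}" "bdd_above ?A" using util_attains_sup by (auto intro: bdd_aboveI[of _ 1])
  obtain a where "a \<in> ?A" "x < a"
    using less_cSupD[OF A(1), of x] assms by (auto simp: bstar_def)
  moreover have "a \<le> bopt" unfolding bstar_def using calculation A(2) by (intro cSup_upper) auto
  ultimately show ?thesis using that by auto
qed

lemma bstar_range: "bopt \<in> {0..1}"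
proof -
  have "bopt - 1 < bopt" by simp
  then obtain a where "a \<in> {0..1}" "a \<le> bopt" using bstar_approx by blast
  moreover have "bopt \<le> 1"
    unfolding bstar_def using util_attains_sup by (intro cSup_least) auto
  ultimately show ?thesis by auto
qed

text \<open>Maximisers \<open>a\<close> accumulate at \<open>bopt\<close> from below, and as long as
  the margin \<open>v - a\<close> is nonnegative, replacing \<open>F a\<close> by
  \<open>F bopt\<close> can only help. The remaining error \<open>(bopt - a) * F bopt\<close>
  vanishes in the limit.\<close>

lemma bstar_optimal:
  assumes "bopt \<le> v" "b \<in> {0..1}"
  shows "util v F b \<le> util v F bopt"
proof (rule field_le_epsilon)
  fix e :: real assume "e > 0"
  then have "bopt - e < bopt" by simp
  then obtain a where a: "bopt - e < a" "a \<le> bopt" "\<forall>b\<in>{0..1}. util v F b \<le> util v F a"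
    using bstar_approx by blast
  have "util v F b \<le> util v F a" using a assms by auto
  also have "\<dots> \<le> (v - a) * F bopt"
    unfolding util_def using a assms by (intro mult_left_mono F_mono) auto
  also have "\<dots> = util v F bopt + (bopt - a) * F bopt" by (simp add: util_def algebra_simps)
  also have "(bopt - a) * F bopt \<le> e * 1" using a F_bounds by (intro mult_mono) auto
  finally show "util v F b \<le> util v F bopt + e" by simp
qed

text \<open>\<open>bstar\<close> is a supremum that need not be attained: if it exceeds \<open>v\<close>, then every bid below it
  never wins and the optimal utility is zero.\<close>
lemma bstar_gt_value:
  assumes "v < bopt"
  shows "b < bopt \<Longrightarrow> F b = 0" and "b \<in> {0..1} \<Longrightarrow> util v F b \<le> 0"
proof -
  have zero: "F a = 0" if a: "v < a" "\<forall>b\<in>{0..1}. util v F b \<le> util v F a" for a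
  proof -
    have "0 \<le> util v F 0" using v_bounds F_bounds by (simp add: util_def)
    also have "\<dots> \<le> util v F a" using a by auto
    finally show ?thesis using a F_bounds(1)[of a] by (auto simp: util_def zero_le_mult_iff)
  qed
  show "F b = 0" if "b < bopt"
  proof -
    have "max b v < bopt" using that assms by simp
    then obtain a where a: "max b v < a" "\<forall>b\<in>{0..1}. util v F b \<le> util v F a"
      using bstar_approx by blast
    then have "F a = 0" using zero by auto
    then show ?thesis using F_mono[of b a] F_bounds(1)[of b] a by auto
  qed
  show "util v F b \<le> 0" if "b \<in> {0..1}"
  proof -
    obtain a where a: "v < a" "\<forall>b\<in>{0..1}. util v F b \<le> util v F a"
      using bstar_approx[OF assms] by blast
    then have "util v F b \<le> util v F a" using that by auto
    also have "\<dots> = 0" using zero a by (simp add: util_def)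
    finally show ?thesis .
  qed
qed

end

section \<open>Good and bad rounds\<close>

context first_price_auction
begin

definition grid_point :: "nat \<Rightarrow> nat \<Rightarrow> real" where
  "grid_point n j = (SOME g. prob {\<omega> \<in> space P. Mc 0 \<omega> < g} \<le> real j / real n \<and>
     (\<forall>b\<in>{0..1}. F b \<le> real j / real n \<longrightarrow> b \<le> g))"

lemma grid_point:
  shows "prob {\<omega> \<in> space P. Mc 0 \<omega> < grid_point n j} \<le> real j / real n"
    and "b \<in> {0..1} \<Longrightarrow> F b \<le> real j / real n \<Longrightarrow> b \<le> grid_point n j"
  using someI_ex[OF quantile_grid_point[of "real j / real n"]] by (auto simp: grid_point_def)

text \<open>The exponential parameters of \<open>peeling\<close> with
  \<open>x = \<gamma> * ln n / 2\<close> and \<open>r = 1 / \<gamma>\<close>;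
  \<open>num_slices\<close> is large enough for the grid to reach \<open>n\<close>.\<close>

definition tilt :: "nat \<Rightarrow> nat \<Rightarrow> real" where
  "tilt n k = 4 * sqrt (\<gamma> * ln (real n) / 2) * (1 / \<gamma>) ^ k"

definition num_slices :: "nat \<Rightarrow> nat" where
  "num_slices n = nat \<lceil>ln (real n) / ln \<gamma>\<rceil>"

definition value_bad :: "nat \<Rightarrow> 'a set" where
  "value_bad n = (\<Union>(k, \<sigma>)\<in>{..num_slices n} \<times> {1, -1}. {\<omega> \<in> space P.
     (\<sigma> * tilt n k) * dev n \<omega> - (\<sigma> * tilt n k)\<^sup>2 / 8 * real (wins n \<omega>) \<ge> (2 - 1 / \<gamma>) * ln (real n)})"

definition utility_bad :: "nat \<Rightarrow> 'a set" where
  "utility_bad n = (\<Union>j\<in>{..n}. {\<omega> \<in> space P.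
     (v - min (real j / real n) bopt - width n) * ecdf_less (\<lambda>s. Mc s \<omega>) n (min (real j / real n) bopt)
     - (v - bopt - width n) * ecdf (\<lambda>s. Mc s \<omega>) n bopt \<ge> 2 * width n - 2 / real n})"

text \<open>The grid is equidistant in probability, not in bids. A deviation of
  \<open>c * width n\<close> has probability at most \<open>n powr (- c ^ 2 * \<gamma>)\<close>, so
  a summable union over about \<open>n\<close> events needs \<open>c ^ 2 * \<gamma> > 2\<close>;
  \<open>c = 3 / 2\<close> achieves this and still fits the budget of
  \<open>round_regret_bound\<close>.\<close>

definition cdf_bad :: "nat \<Rightarrow> 'a set" where
  "cdf_bad n = {\<omega> \<in> space P. F bopt - ecdf (\<lambda>s. Mc s \<omega>) n bopt \<ge> 3 / 2 * width n} \<union>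
     (\<Union>j\<in>{j \<in> {..n}. bopt < grid_point n j}. {\<omega> \<in> space P.
       (ecdf_less (\<lambda>s. Mc s \<omega>) n (grid_point n j) - ecdf (\<lambda>s. Mc s \<omega>) n bopt)
       - (prob {\<omega> \<in> space P. Mc 0 \<omega> < grid_point n j} - F bopt) \<ge> 3 / 2 * width n})"

text \<open>If \<open>bopt\<close> exceeds \<open>v\<close>, bids below it never win and the optimal
  utility is 0; control of overbidding, hence of the value estimate, is then sufficient.\<close>

definition bad :: "nat \<Rightarrow> 'a set" where
  "bad n = value_bad n \<union> (if bopt \<le> v then utility_bad n \<union> cdf_bad n else {})"

lemma ecdf_measurable [measurable]:
  "(\<lambda>\<omega>. ecdf (\<lambda>s. Mc s \<omega>) n b) \<in> borel_measurable P"
  "(\<lambda>\<omega>. ecdf_less (\<lambda>s. Mc s \<omega>) n b) \<in> borel_measurable P"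
  by (rule measurable_ecdf measurable_ecdf_less; simp)+

lemma bad_sets [measurable]:
  "value_bad n \<in> sets P" "utility_bad n \<in> sets P" "cdf_bad n \<in> sets P" "bad n \<in> sets P"
proof -
  show 1: "value_bad n \<in> sets P"
    unfolding value_bad_def by (intro sets.finite_UN) (auto simp: case_prod_beta)
  show 2: "utility_bad n \<in> sets P"
    unfolding utility_bad_def by (intro sets.finite_UN) auto
  show 3: "cdf_bad n \<in> sets P"
    unfolding cdf_bad_def by (intro sets.Un sets.finite_UN) auto
  show "bad n \<in> sets P" unfolding bad_def using 1 2 3 by auto
qed

section \<open>Probabilities of the bad events\<close>

lemma value_bad_bound:
  "prob (value_bad n) \<le> 2 * real (num_slices n + 1) * exp (- ((2 - 1 / \<gamma>) * ln (real n)))"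
proof -
  let ?A = "\<lambda>i. {\<omega> \<in> space P. (snd i * tilt n (fst i)) * dev n \<omega>
     - (snd i * tilt n (fst i))\<^sup>2 / 8 * real (wins n \<omega>) \<ge> (2 - 1 / \<gamma>) * ln (real n)}"
  have "prob (value_bad n) = prob (\<Union>i\<in>{..num_slices n} \<times> {1, -1}. ?A i)"
    unfolding value_bad_def by (simp add: case_prod_beta)
  also have "\<dots> \<le> (\<Sum>i\<in>{..num_slices n} \<times> {1, -1}. prob (?A i))"
    by (intro finite_measure_subadditive_finite) auto
  also have "\<dots> \<le> (\<Sum>i\<in>{..num_slices n} \<times> {1, -1 :: real}. exp (- ((2 - 1 / \<gamma>) * ln (real n))))"
    by (intro sum_mono prob_dev)
  also have "\<dots> = 2 * real (num_slices n + 1) * exp (- ((2 - 1 / \<gamma>) * ln (real n)))"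
    by (simp add: card_cartesian_product)
  finally show ?thesis .
qed

lemma utility_bad_bound:
  assumes "bopt \<le> v" "n \<ge> 1" "0 < width n" "width n \<le> 1 / 6"
  shows "prob (utility_bad n) \<le> real (n + 1) *
    exp (- (2 * \<gamma> * ln (real n)) + 12 * width n + 234 * (real n * width n ^ 3))"
proof -
  let ?g = "\<lambda>j. min (real j / real n) bopt"
  have "prob (utility_bad n) \<le> (\<Sum>j\<in>{..n}. prob {\<omega> \<in> space P.
     (v - ?g j - width n) * ecdf_less (\<lambda>s. Mc s \<omega>) n (?g j)
     - (v - bopt - width n) * ecdf (\<lambda>s. Mc s \<omega>) n bopt \<ge> 2 * width n - 2 / real n})"
    unfolding utility_bad_def by (intro finite_measure_subadditive_finite) auto
  also have "\<dots> \<le> (\<Sum>j\<in>{..n}. exp (- 4 * (real n * (width n)\<^sup>2) + 12 * width n + 234 * (real n * width n ^ 3)))"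
    using assms bstar_range by (intro sum_mono prob_utility_gap bstar_optimal) auto
  also have "\<dots> = real (n + 1) * exp (- (2 * \<gamma> * ln (real n)) + 12 * width n + 234 * (real n * width n ^ 3))"
    unfolding width_sq[OF assms(2)] by (simp add: mult.assoc)
  finally show ?thesis .
qed

lemma cdf_bad_bound:
  assumes "n \<ge> 1"
  shows "prob (cdf_bad n) \<le> real (n + 2) * exp (- (9 / 4 * \<gamma> * ln (real n)))"
proof -
  have e: "- 2 * real n * (3 / 2 * width n)\<^sup>2 = - (9 / 4 * \<gamma> * ln (real n))"
  proof -
    have "- 2 * real n * (3 / 2 * width n)\<^sup>2 = - (9 / 2) * (real n * (width n)\<^sup>2)"
      by (simp add: power_mult_distrib power_divide)
    then show ?thesis unfolding width_sq[OF assms] by simp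
  qed
  let ?J = "{j \<in> {..n}. bopt < grid_point n j}"
  let ?A = "{\<omega> \<in> space P. F bopt - ecdf (\<lambda>s. Mc s \<omega>) n bopt \<ge> 3 / 2 * width n}"
  let ?B = "\<lambda>j. {\<omega> \<in> space P.
       (ecdf_less (\<lambda>s. Mc s \<omega>) n (grid_point n j) - ecdf (\<lambda>s. Mc s \<omega>) n bopt)
       - (prob {\<omega> \<in> space P. Mc 0 \<omega> < grid_point n j} - F bopt) \<ge> 3 / 2 * width n}"
  have w: "0 \<le> 3 / 2 * width n" using width_nonneg[of n] by simp
  have "prob (cdf_bad n) \<le> prob ?A + prob (\<Union>j\<in>?J. ?B j)"
    unfolding cdf_bad_def by (intro measure_Un_le sets.finite_UN) auto
  also have "prob (\<Union>j\<in>?J. ?B j) \<le> (\<Sum>j\<in>?J. prob (?B j))"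
    by (intro finite_measure_subadditive_finite) auto
  also have "\<dots> \<le> (\<Sum>j\<in>?J. exp (- 2 * real n * (3 / 2 * width n)\<^sup>2))"
    using w assms by (intro sum_mono prob_ecdf_gap) auto
  also have "\<dots> \<le> (\<Sum>j\<in>{..n}. exp (- 2 * real n * (3 / 2 * width n)\<^sup>2))"
    by (intro sum_mono2) auto
  also have "prob ?A \<le> exp (- 2 * real n * (3 / 2 * width n)\<^sup>2)"
    by (rule prob_ecdf_dev[OF w assms])
  finally show ?thesis unfolding e by (simp add: algebra_simps)
qed

section \<open>Consequences of a good round\<close>

lemma rad_ge_width:
  assumes "\<omega> \<in> space P" "n \<ge> 1" shows "width n \<le> rad n \<omega>"
proof -
  have "real (wins n \<omega>) \<ge> 1" "real (wins n \<omega>) \<le> real n"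
    using wins_pos[OF assms] win_count_le by auto
  then show ?thesis
    unfolding width_def radius_def using \<gamma> assms by (intro real_sqrt_le_mono divide_left_mono) auto
qed

text \<open>A failure means that \<open>dev\<close> is at least \<open>sqrt (N * x)\<close> in
  absolute value at the random count \<open>N\<close>, and \<open>peeling\<close> then finds a slice
  whose event in \<open>value_bad\<close> occurs, with \<open>\<sigma>\<close> the sign of
  \<open>dev\<close>. The factor \<open>\<gamma>\<close> in the radius pays for the slicing:
  \<open>2 * x * r * (2 - r)\<close> is \<open>(2 - 1 / \<gamma>) * ln n\<close>.\<close>

lemma value_good:
  assumes \<omega>: "\<omega> \<in> space P" "\<omega> \<notin> value_bad n" and n: "n \<ge> 1"
  shows "\<bar>vmean n \<omega> - v\<bar> < rad n \<omega>"
proof (rule ccontr)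
  assume not: "\<not> \<bar>vmean n \<omega> - v\<bar> < rad n \<omega>"
  define N where "N = real (wins n \<omega>)"
  define x where "x = \<gamma> * ln (real n) / 2"
  have N: "1 \<le> N" "N \<le> real n" unfolding N_def using wins_pos[OF \<omega>(1) n] win_count_le by auto
  have x: "0 \<le> x" using \<gamma> n by (simp add: x_def)
  have d: "dev n \<omega> = N * (vmean n \<omega> - v)"
    using N by (simp add: dev_def value_mean_def N_def field_simps)
  have "rad n \<omega> = sqrt (x / N)" by (simp add: radius_def x_def N_def)
  then have "sqrt N * (sqrt N * rad n \<omega>) = sqrt (N * x)"
    using N by (simp add: real_sqrt_mult real_sqrt_divide del: real_sqrt_mult_self)
  then have "N * rad n \<omega> = sqrt (N * x)"
    using N by (simp add: mult.assoc[symmetric])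
  moreover have "N * rad n \<omega> \<le> N * \<bar>vmean n \<omega> - v\<bar>" using not N by (intro mult_left_mono) auto
  ultimately have S: "sqrt (N * x) \<le> \<bar>dev n \<omega>\<bar>" using N by (simp add: d abs_mult)
  obtain \<sigma> :: real where \<sigma>: "\<sigma> \<in> {1, -1}" "\<bar>dev n \<omega>\<bar> = \<sigma> * dev n \<omega>"
    by (intro that[of "if dev n \<omega> \<ge> 0 then 1 else - 1"]) auto
  have K: "real n \<le> (1 / (1 / \<gamma>)) ^ num_slices n"
  proof -
    have "ln (real n) / ln \<gamma> \<le> real (num_slices n)" unfolding num_slices_def by linarith
    then have "ln (real n) \<le> real (num_slices n) * ln \<gamma>" using \<gamma> by (simp add: field_simps)
    also have "\<dots> = ln (\<gamma> ^ num_slices n)" using \<gamma> by (simp add: ln_realpow)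
    finally show ?thesis using \<gamma> n by simp
  qed
  obtain k where k: "k \<le> num_slices n"
    "2 * x * (1 / \<gamma> * (2 - 1 / \<gamma>)) \<le> (4 * sqrt x * (1 / \<gamma>) ^ k) * (\<sigma> * dev n \<omega>)
      - (4 * sqrt x * (1 / \<gamma>) ^ k)\<^sup>2 / 8 * N"
    using peeling[OF N _ _ x K, of "\<sigma> * dev n \<omega>"] S \<sigma> \<gamma> by auto
  have "2 * x * (1 / \<gamma> * (2 - 1 / \<gamma>)) = (2 - 1 / \<gamma>) * ln (real n)"
    using \<gamma> by (simp add: x_def)
  moreover have "4 * sqrt x * (1 / \<gamma>) ^ k = tilt n k" by (simp add: tilt_def x_def)
  moreover have "(\<sigma> * tilt n k)\<^sup>2 = (tilt n k)\<^sup>2" using \<sigma> by auto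
  ultimately have "(2 - 1 / \<gamma>) * ln (real n) \<le> (\<sigma> * tilt n k) * dev n \<omega> - (\<sigma> * tilt n k)\<^sup>2 / 8 * real (wins n \<omega>)"
    using k(2) by (simp add: N_def mult_ac)
  then have "\<omega> \<in> value_bad n"
    unfolding value_bad_def using \<omega> k(1) \<sigma>(1) by (intro UN_I[of "(k, \<sigma>)"]) auto
  with \<omega> show False by simp
qed

lemma utility_good:
  assumes \<omega>: "\<omega> \<in> space P" "\<omega> \<notin> value_bad n" "\<omega> \<notin> utility_bad n"
    and n: "n \<ge> 1" "1 / real n \<le> width n" and b: "bopt \<le> v" "bopt < 1"
  shows "\<exists>b\<in>candidates (vmean n \<omega>) (rad n \<omega>) (ecdf_less (\<lambda>s. Mc s \<omega>) n). bopt < b"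
proof -
  let ?G = "ecdf_less (\<lambda>s. Mc s \<omega>) n"
  define f where "f = ecdf (\<lambda>s. Mc s \<omega>) n bopt"
  define a where "a = vmean n \<omega>"
  define e where "e = rad n \<omega>"
  define \<delta> where "\<delta> = width n"
  have a: "\<bar>a - v\<bar> < e" unfolding a_def e_def by (rule value_good) fact+
  have e: "\<delta> \<le> e" unfolding \<delta>_def e_def by (rule rad_ge_width) fact+
  have \<delta>n: "1 / real n \<le> \<delta>" using n by (simp add: \<delta>_def)
  have f: "0 \<le> f" "f \<le> 1" unfolding f_def by (rule ecdf_bounds)+
  have grid: "(v - c - \<delta>) * ?G c - (v - bopt - \<delta>) * f \<le> 2 * \<delta> - 1 / real n"
    if c: "0 \<le> c" "c \<le> bopt" for c
  proof (cases "v - c - \<delta> \<le> 0")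
    case True
    then have "(v - c - \<delta>) * ?G c \<le> 0" using ecdf_less_bounds by (intro mult_nonpos_nonneg)
    moreover have "0 \<le> (v - bopt) * f" using b f by simp
    moreover have "\<delta> * f \<le> \<delta> * 1" using f \<delta>n n by (intro mult_left_mono) (auto simp: \<delta>_def width_nonneg)
    moreover have "(v - bopt - \<delta>) * f = (v - bopt) * f - \<delta> * f" by (simp add: algebra_simps)
    ultimately show ?thesis using \<delta>n by linarith
  next
    case False
    define j where "j = nat \<lceil>real n * c\<rceil>"
    define g where "g = min (real j / real n) bopt"
    have "real n * c \<le> real j" unfolding j_def by linarith
    then have "c \<le> real j / real n" using n by (simp add: field_simps)
    then have cg: "c \<le> g" using c by (simp add: g_def)
    have "real n * c \<ge> 0" using c by simp
    then have "real j \<le> real n * c + 1" unfolding j_def by linarith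
    then have "real j / real n \<le> c + 1 / real n" using n by (simp add: field_simps)
    then have gc: "g - c \<le> 1 / real n" by (simp add: g_def)
    have "c \<le> 1" using c b by simp
    then have "real n * c \<le> real n" using c by (simp add: mult_left_le)
    then have jn: "j \<le> n" unfolding j_def by linarith
    have "(v - c - \<delta>) * ?G c \<le> (v - c - \<delta>) * ?G g"
      using False ecdf_less_mono[OF cg] by (intro mult_left_mono) auto
    also have "\<dots> = (v - g - \<delta>) * ?G g + (g - c) * ?G g" by (simp add: algebra_simps)
    also have "(g - c) * ?G g \<le> 1 / real n * 1"
      using gc ecdf_less_bounds by (intro mult_mono) auto
    finally have "(v - c - \<delta>) * ?G c \<le> (v - g - \<delta>) * ?G g + 1 / real n" by simp
    moreover have "\<not> 2 * \<delta> - 2 / real n \<le> (v - g - \<delta>) * ?G g - (v - bopt - \<delta>) * f"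
      using \<omega>(1,3) jn unfolding utility_bad_def g_def f_def \<delta>_def by auto
    ultimately show ?thesis by simp
  qed
  have "\<exists>b\<in>candidates a e ?G. bopt < b"
  proof (rule candidate_gt[where r = "1 / real n"])
    show "0 \<le> bopt" using bstar_range by simp
    show "bopt < 1" "0 < 1 / real n" using b n by auto
    show "bopt < a + e" using a b by linarith
    show "1 / real n \<le> e" using e \<delta>n by linarith
    then show "0 < e" using \<open>0 < 1 / real n\<close> by (rule less_le_trans[rotated])
    fix c assume c: "0 \<le> c" "c \<le> bopt"
    have G: "?G c \<le> f" unfolding f_def by (rule ecdf_less_le_ecdf) fact
    have "(a - c) * ?G c - (a - bopt) * f
        = ((v - c - \<delta>) * ?G c - (v - bopt - \<delta>) * f) + ((v - a) - \<delta>) * (f - ?G c)"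
      by (simp add: algebra_simps)
    also have "\<dots> \<le> (2 * \<delta> - 1 / real n) + (e - \<delta>) * (f - ?G c)"
      using a G by (intro add_mono[OF grid[OF c] mult_right_mono]) auto
    also have "\<dots> \<le> (2 * \<delta> - 1 / real n) + (e - \<delta>) * 1"
      using e f ecdf_less_bounds(1)[of "\<lambda>s. Mc s \<omega>" n c]
      by (intro add_left_mono mult_left_mono) auto
    also have "\<dots> \<le> 2 * e - 1 / real n" using e by simp
    finally have "(a - c) * ?G c \<le> (a - bopt) * f + 2 * e - 1 / real n" by simp
    then show "(a - c) * ?G c \<le> (a - bopt) * ecdf (\<lambda>s. Mc s \<omega>) n bopt + 2 * e - 1 / real n"
      by (simp add: f_def)
  qed
  then show ?thesis by (simp add: a_def e_def)
qed

lemma good_round: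
  assumes \<omega>: "\<omega> \<in> space P" "\<omega> \<notin> bad n" and pos: "F bopt > 0"
    and n: "n \<ge> 1" "1 / real n \<le> width n / 8" "width n \<le> 1 / 12"
  shows "(SUP b\<in>{0..1}. util v F b) - util v F (bid (Suc n) \<omega>)
    \<le> 4 / F bopt * (rad n \<omega> * F (bid (Suc n) \<omega>))"
proof -
  define B where "B = bid (Suc n) \<omega>"
  have B01: "B \<in> {0..1}" unfolding B_def by (rule bid_in_unit) (use \<omega> in auto)
  let ?G = "ecdf_less (\<lambda>s. Mc s \<omega>) n"
  have Beq: "B = upper_bid (vmean n \<omega>) (rad n \<omega>) ?G"
    unfolding B_def by (rule oucb_bid_Suc[OF n(1)])
  have w0: "0 < width n" using n(1,2) less_le_trans[of 0 "1 / real n" "width n / 8"] by simp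
  have we: "width n \<le> rad n \<omega>" using rad_ge_width \<omega> n by auto
  have val: "\<bar>vmean n \<omega> - v\<bar> < rad n \<omega>"
    using value_good[OF \<omega>(1) _ n(1)] \<omega>(2) by (auto simp: bad_def)
  have Ble: "B \<le> vmean n \<omega> + rad n \<omega>"
    using upper_bid_le[of "vmean n \<omega>" "rad n \<omega>" ?G] by (simp add: Beq)
  have rhs0: "0 \<le> 4 / F bopt * (rad n \<omega> * F B)"
    using pos we w0 F_bounds by simp
  consider "v < bopt" | "bopt \<le> v" "bopt = 1" | "bopt \<le> v" "bopt < 1"
    using bstar_range by force
  then have "(SUP b\<in>{0..1}. util v F b) - util v F B \<le> 4 / F bopt * (rad n \<omega> * F B)"
  proof cases
    case 1
    have best: "(SUP b\<in>{0..1}. util v F b) \<le> 0"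
      using bstar_gt_value(2)[OF 1] by (intro cSUP_least) auto
    show ?thesis
    proof (cases "B < bopt")
      case True
      then have "util v F B = 0" using bstar_gt_value(1)[OF 1] by (simp add: util_def)
      then show ?thesis using best rhs0 by linarith
    next
      case False
      have "(B - v) * F B \<le> 2 * rad n \<omega> * F B"
        using Ble val F_bounds by (intro mult_right_mono) auto
      also have "\<dots> \<le> 4 / F bopt * (rad n \<omega> * F B)"
      proof -
        have "2 \<le> 4 / F bopt" using pos F_bounds(2)[of bopt] by (simp add: field_simps)
        then have "2 * (rad n \<omega> * F B) \<le> 4 / F bopt * (rad n \<omega> * F B)"
          using we w0 F_bounds by (intro mult_right_mono) auto
        then show ?thesis by simp
      qed
      finally show ?thesis using best by (simp add: util_def algebra_simps)
    qed
  next
    case 2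
    have "(SUP b\<in>{0..1}. util v F b) \<le> util v F bopt"
      using bstar_optimal[OF 2(1)] by (intro cSUP_least) auto
    also have "\<dots> = 0" using 2 v_bounds by (simp add: util_def)
    also have "0 \<le> util v F B" using 2 v_bounds B01 F_bounds by (simp add: util_def)
    finally show ?thesis using rhs0 by linarith
  next
    case 3
    have nb: "\<omega> \<notin> value_bad n" "\<omega> \<notin> utility_bad n" "\<omega> \<notin> cdf_bad n"
      using \<omega>(2) 3 by (auto simp: bad_def)
    obtain c where c: "c \<in> candidates (vmean n \<omega>) (rad n \<omega>) ?G" "bopt < c"
      using utility_good[OF \<omega>(1) nb(1,2) n(1) _ 3] n w0 by auto
    then have gt: "bopt < B" using upper_bid_ge[OF c(1)] by (simp add: Beq)
    define fs where "fs = ecdf (\<lambda>s. Mc s \<omega>) n bopt"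
    have low: "F bopt - fs \<le> 3 / 2 * width n"
      using nb(3) \<omega>(1) by (auto simp: cdf_bad_def fs_def)
    define j where "j = nat \<lceil>real n * F B\<rceil>"
    have nF: "0 \<le> real n * F B" using F_bounds by simp
    have j1: "F B \<le> real j / real n"
    proof -
      have "real n * F B \<le> real j" unfolding j_def by linarith
      then show ?thesis using n by (simp add: field_simps)
    qed
    have j2: "real j / real n \<le> F B + 1 / real n"
    proof -
      have "real j \<le> real n * F B + 1" unfolding j_def using nF by linarith
      then show ?thesis using n by (simp add: field_simps)
    qed
    have j3: "j \<le> n"
    proof -
      have "real n * F B \<le> real n" using F_bounds(2)[of B] by (simp add: mult_left_le)
      then show ?thesis unfolding j_def by linarith
    qed
    define g where "g = grid_point n j"
    have Bg: "B \<le> g" unfolding g_def by (rule grid_point(2)[OF B01 j1])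
    have "(?G g - fs) - (prob {\<omega> \<in> space P. Mc 0 \<omega> < g} - F bopt) < 3 / 2 * width n"
    proof (rule ccontr)
      assume "\<not> ?thesis"
      then have "\<omega> \<in> cdf_bad n"
        unfolding cdf_bad_def fs_def g_def using \<omega>(1) j3 gt Bg
        by (intro UnI2 UN_I[of j]) (auto simp: g_def)
      with nb(3) show False by simp
    qed
    moreover have "prob {\<omega> \<in> space P. Mc 0 \<omega> < g} \<le> F B + 1 / real n"
      using grid_point(1)[of n j] j2 by (simp add: g_def)
    moreover have "?G B \<le> ?G g" by (rule ecdf_less_mono[OF Bg])
    ultimately have gap: "?G B - fs \<le> F B - F bopt + 1 / real n + 3 / 2 * width n" by linarith
    have "candidates (vmean n \<omega>) (rad n \<omega>) ?G \<noteq> {}" using c by blast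
    then have "B \<in> candidates (vmean n \<omega>) (rad n \<omega>) ?G"
      unfolding Beq by (rule upper_bid_in_candidates)
    then have "(SUP b\<in>{0..1}. (vmean n \<omega> - b) * ?G b) - 2 * rad n \<omega> \<le> (vmean n \<omega> - B) * ?G B"
      by (simp add: candidates_def)
    then have opt: "(vmean n \<omega> - bopt) * fs - 2 * rad n \<omega> \<le> (vmean n \<omega> - B) * ?G B"
      using empirical_utility_sup_ge[of bopt "vmean n \<omega>" "\<lambda>s. Mc s \<omega>" n] bstar_range 3 by (auto simp: fs_def)
    have "(SUP b\<in>{0..1}. util v F b) \<le> util v F bopt"
      using bstar_optimal[OF 3(1)] by (intro cSUP_least) auto
    also have "util v F bopt - util v F B \<le> 4 / F bopt * (rad n \<omega> * F B)"
      unfolding util_def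
    proof (rule round_regret_bound[where \<delta> = "width n" and \<eta> = "1 / real n" and fs = fs and fB = "?G B" and hv = "vmean n \<omega>"])
      show "fs \<le> ?G B" unfolding fs_def by (rule ecdf_le_ecdf_less[OF gt])
      show "0 \<le> fs" unfolding fs_def by (rule ecdf_bounds)
    qed (use 3 v_bounds bstar_range gt Ble val w0 we n pos F_bounds F_mono low gap opt in auto)
    finally show ?thesis by simp
  qed
  then show ?thesis by (simp add: B_def)
qed

end

section \<open>Summation over the rounds\<close>

context first_price_auction
begin

lemma eventually_width:
  "eventually (\<lambda>n. n \<ge> 1 \<and> 1 / real n \<le> width n / 8 \<and> width n \<le> 1 / 12 \<and>
     12 * width n + 234 * (real n * width n ^ 3) \<le> 1) sequentially"
proof -
  have g: "\<gamma> > 0" using \<gamma> by simp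
  have "eventually (\<lambda>n. 1 / real n \<le> width n / 8) sequentially"
    unfolding width_def using g by real_asymp
  moreover have "eventually (\<lambda>n. width n \<le> 1 / 12) sequentially"
    unfolding width_def using g by real_asymp
  moreover have "eventually (\<lambda>n. 12 * width n + 234 * (real n * width n ^ 3) \<le> 1) sequentially"
    unfolding width_def using g by real_asymp
  ultimately show ?thesis
    using eventually_ge_at_top[of 1] by eventually_elim simp
qed

lemma summable_bad: "summable (\<lambda>n. prob (bad n))"
proof -
  define c where "c = 1 / \<gamma>"
  define L where "L = 1 / ln \<gamma>"
  have c: "0 < c" "c < 1" and L: "0 < L" using \<gamma> by (auto simp: c_def L_def)
  define h1 where "h1 n = 2 * (L * ln (real n) + 2) * real n powr (- (2 - c))" for n
  define h2 where "h2 n = real (n + 1) * exp 1 * real n powr (- (2 * \<gamma>))" for n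
  define h3 where "h3 n = real (n + 2) * real n powr (- (9 / 4 * \<gamma>))" for n
  have "summable h1"
  proof (rule summable_comparison_test_bigo)
    show "summable (\<lambda>n. norm (real n powr (- (3 / 2 - c / 2))))"
      using c by (simp add: summable_real_powr_iff)
    show "h1 \<in> O(\<lambda>n. real n powr (- (3 / 2 - c / 2)))"
      unfolding h1_def using c L by real_asymp
  qed
  moreover have "summable h2"
  proof (rule summable_comparison_test_bigo)
    show "summable (\<lambda>n. norm (real n powr (1 - 2 * \<gamma>)))"
      using \<gamma> by (simp add: summable_real_powr_iff)
    show "h2 \<in> O(\<lambda>n. real n powr (1 - 2 * \<gamma>))"
      unfolding h2_def by real_asymp
  qed
  moreover have "summable h3"
  proof (rule summable_comparison_test_bigo)
    show "summable (\<lambda>n. norm (real n powr (1 - 9 / 4 * \<gamma>)))"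
      using \<gamma> by (simp add: summable_real_powr_iff)
    show "h3 \<in> O(\<lambda>n. real n powr (1 - 9 / 4 * \<gamma>))"
      unfolding h3_def by real_asymp
  qed
  ultimately have sum: "summable (\<lambda>n. h1 n + (h2 n + h3 n))" by (intro summable_add)
  have powr: "exp (- (e * ln (real n))) = real n powr (- e)" if "n \<ge> 1" for e n
    using that by (simp add: powr_def)
  have h0: "0 \<le> h2 n" "0 \<le> h3 n" for n by (auto simp: h2_def h3_def)
  have "eventually (\<lambda>n. norm (prob (bad n)) \<le> h1 n + (h2 n + h3 n)) sequentially"
    using eventually_width
  proof eventually_elim
    case (elim n)
    then have n: "n \<ge> 1" by simp
    have w0: "0 < width n"
      using elim less_le_trans[of 0 "1 / real n" "width n / 8"] by simp
    have "0 \<le> ln (real n) / ln \<gamma>" using n \<gamma> by simp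
    then have "real (num_slices n) \<le> L * ln (real n) + 1"
      unfolding num_slices_def L_def by simp
    then have "2 * real (num_slices n + 1) * exp (- ((2 - 1 / \<gamma>) * ln (real n))) \<le> h1 n"
      unfolding h1_def c_def powr[OF n] by (intro mult_right_mono) auto
    then have v: "prob (value_bad n) \<le> h1 n" using value_bad_bound[of n] by linarith
    have u: "prob (utility_bad n) \<le> h2 n" if "bopt \<le> v"
    proof -
      have "prob (utility_bad n) \<le> real (n + 1) *
          exp (- (2 * \<gamma> * ln (real n)) + 12 * width n + 234 * (real n * width n ^ 3))"
        using elim w0 that by (intro utility_bad_bound) auto
      also have "\<dots> \<le> real (n + 1) * exp (1 + - (2 * \<gamma> * ln (real n)))"
        using elim by (intro mult_left_mono) auto
      also have "\<dots> = h2 n" unfolding exp_add powr[OF n] h2_def by simp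
      finally show ?thesis .
    qed
    have f: "prob (cdf_bad n) \<le> h3 n"
      using cdf_bad_bound[OF n] unfolding powr[OF n] h3_def .
    have "prob (bad n) \<le> h1 n + (h2 n + h3 n)"
    proof (cases "bopt \<le> v")
      case True
      then have "prob (bad n) \<le> prob (value_bad n) + prob (utility_bad n \<union> cdf_bad n)"
        unfolding bad_def by (simp add: measure_Un_le)
      also have "prob (utility_bad n \<union> cdf_bad n) \<le> prob (utility_bad n) + prob (cdf_bad n)"
        by (intro measure_Un_le) auto
      finally show ?thesis using u[OF True] v f by linarith
    next
      case False
      then show ?thesis using v h0[of n] by (simp add: bad_def)
    qed
    then show ?case by simp
  qed
  then show ?thesis using sum by (rule summable_comparison_test_ev)
qed

lemma sum_rad_wins:
  assumes \<omega>: "\<omega> \<in> space P" and T: "T \<ge> 1"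
  shows "(\<Sum>n\<in>{1..<T}. rad n \<omega> * (if Mc (Suc n) \<omega> \<le> bid (Suc n) \<omega> then 1 else 0))
    \<le> sqrt (\<gamma> * ln (real T) / 2) * (2 * sqrt (real T))"
proof -
  let ?w = "\<lambda>n. if Mc (Suc n) \<omega> \<le> bid (Suc n) \<omega> then 1 / sqrt (real (wins n \<omega>)) else 0"
  have "(\<Sum>n\<in>{1..<T}. rad n \<omega> * (if Mc (Suc n) \<omega> \<le> bid (Suc n) \<omega> then 1 else 0))
      \<le> (\<Sum>n\<in>{1..<T}. sqrt (\<gamma> * ln (real T) / 2) * ?w n)"
  proof (rule sum_mono)
    fix n assume n: "n \<in> {1..<T}"
    have "rad n \<omega> = sqrt (\<gamma> * ln (real n) / 2) * (1 / sqrt (real (wins n \<omega>)))"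
      unfolding radius_def by (simp add: real_sqrt_divide real_sqrt_mult)
    also have "\<dots> \<le> sqrt (\<gamma> * ln (real T) / 2) * (1 / sqrt (real (wins n \<omega>)))"
      using n \<gamma> by (intro mult_right_mono real_sqrt_le_mono divide_right_mono mult_left_mono) auto
    finally show "rad n \<omega> * (if Mc (Suc n) \<omega> \<le> bid (Suc n) \<omega> then 1 else 0)
      \<le> sqrt (\<gamma> * ln (real T) / 2) * ?w n" by simp
  qed
  also have "\<dots> = sqrt (\<gamma> * ln (real T) / 2) * (\<Sum>n\<in>{1..<T}. ?w n)"
    by (simp add: sum_distrib_left)
  also have "(\<Sum>n\<in>{1..<T}. ?w n) \<le> 2 * sqrt (real (wins T \<omega>) - 1)"
    using M_range[OF \<omega>] T by (intro sum_wins_le) auto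
  also have "2 * sqrt (real (wins T \<omega>) - 1) \<le> 2 * sqrt (real T)"
  proof -
    have "wins T \<omega> \<le> T" by (rule win_count_le)
    then show ?thesis by simp
  qed
  finally show ?thesis using \<gamma> T by (simp add: mult_left_mono)
qed

lemma rad_bound:
  assumes "\<omega> \<in> space P" "n \<ge> 1" shows "\<bar>rad n \<omega>\<bar> \<le> sqrt (\<gamma> * ln (real n) / 2)"
proof -
  have w: "real (wins n \<omega>) \<ge> 1" using wins_pos[OF assms] by simp
  have "\<gamma> * ln (real n) / (2 * real (wins n \<omega>)) \<le> \<gamma> * ln (real n) / 2"
    using w \<gamma> assms by (intro divide_left_mono) auto
  moreover have "0 \<le> rad n \<omega>" using \<gamma> by (intro radius_nonneg) simp
  ultimately show ?thesis unfolding radius_def by simp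
qed

lemma expectation_win:
  "expectation (\<lambda>\<omega>. rad n \<omega> * F (bid (Suc n) \<omega>))
    = expectation (\<lambda>\<omega>. rad n \<omega> * (if Mc (Suc n) \<omega> \<le> bid (Suc n) \<omega> then 1 else 0))"
proof -
  have r: "0 \<le> rad n \<omega>" for \<omega> using \<gamma> by (intro radius_nonneg) simp
  have "expectation (\<lambda>\<omega>. rad n \<omega> * F (bid (Suc n) \<omega>))
      = enn2real (\<integral>\<^sup>+\<omega>. ennreal (rad n \<omega> * F (bid (Suc n) \<omega>)) \<partial>P)"
    using r F_bounds by (intro integral_eq_nn_integral) auto
  also have "\<dots> = expectation (\<lambda>\<omega>. rad n \<omega> * (if Mc (Suc n) \<omega> \<le> bid (Suc n) \<omega> then 1 else 0))"
    unfolding nn_integral_win[symmetric] using r by (intro integral_eq_nn_integral[symmetric]) auto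
  finally show ?thesis .
qed

lemma regret_bound:
  assumes pos: "F bopt > 0"
  shows "\<exists>C. \<forall>T\<ge>1. regret P v F bid T
    \<le> 4 * sqrt 2 / F bopt * sqrt (\<gamma> * ln (real T)) * (sqrt (real T) + 1) + C"
proof -
  define best where "best = (SUP b\<in>{0..1}. util v F b)"
  obtain n0 where n0: "\<And>n. n \<ge> n0 \<Longrightarrow> n \<ge> 1 \<and> 1 / real n \<le> width n / 8 \<and> width n \<le> 1 / 12"
    using eventually_width unfolding eventually_sequentially by blast
  define c where "c n = (if n < n0 then 2 else 2 * prob (bad n))" for n
  have "summable (\<lambda>n. 2 * prob (bad n))" using summable_bad by (rule summable_mult)
  then have c_sum: "summable c"
    by (rule summable_cong[THEN iffD1, rotated])
      (auto simp: c_def eventually_sequentially intro!: exI[of _ n0])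
  have c0: "0 \<le> c n" for n by (simp add: c_def)
  have best_le: "best - util v F (bid t \<omega>) \<le> 2" if "\<omega> \<in> space P" "t \<ge> 1" for \<omega> t
  proof -
    have "best \<le> 1" unfolding best_def using util_le_1 by (intro cSUP_least) auto
    then show ?thesis using util_ge_neg1[OF bid_in_unit[OF that]] by linarith
  qed
  have [measurable]: "(\<lambda>\<omega>. util v F (bid t \<omega>)) \<in> borel_measurable P" for t
    unfolding util_def by measurable
  have int_util: "integrable P (\<lambda>\<omega>. util v F (bid t \<omega>))" if "t \<ge> 1" for t
  proof (rule integrable_const_bound[of _ 1])
    show "AE \<omega> in P. norm (util v F (bid t \<omega>)) \<le> 1"
    proof (rule AE_I2)
      fix \<omega> assume "\<omega> \<in> space P"
      then show "norm (util v F (bid t \<omega>)) \<le> 1"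
        using util_ge_neg1 util_le_1 bid_in_unit[of \<omega> t] that by (auto simp: abs_le_iff)
    qed
  qed simp
  have int_diff: "expectation (\<lambda>\<omega>. best - util v F (bid t \<omega>)) = best - expectation (\<lambda>\<omega>. util v F (bid t \<omega>))"
    if "t \<ge> 1" for t
    using int_util[OF that] by (subst Bochner_Integration.integral_diff) (auto simp: prob_space)
  have int_rad: "integrable P (\<lambda>\<omega>. rad n \<omega> * g \<omega>)"
    if "n \<ge> 1" and [measurable]: "g \<in> borel_measurable P" and g: "\<And>\<omega>. \<bar>g \<omega>\<bar> \<le> 1" for n g
  proof (rule integrable_const_bound[of _ "sqrt (\<gamma> * ln (real n) / 2)"])
    show "AE \<omega> in P. norm (rad n \<omega> * g \<omega>) \<le> sqrt (\<gamma> * ln (real n) / 2)"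
    proof (rule AE_I2)
      fix \<omega> assume "\<omega> \<in> space P"
      then have "\<bar>rad n \<omega>\<bar> * \<bar>g \<omega>\<bar> \<le> sqrt (\<gamma> * ln (real n) / 2) * 1"
        using rad_bound that g \<gamma> by (intro mult_mono) auto
      then show "norm (rad n \<omega> * g \<omega>) \<le> sqrt (\<gamma> * ln (real n) / 2)" by (simp add: abs_mult)
    qed
  qed simp
  define win where "win n \<omega> = (if Mc (Suc n) \<omega> \<le> bid (Suc n) \<omega> then 1 else 0 :: real)" for n \<omega>
  have [measurable]: "win n \<in> borel_measurable P" for n unfolding win_def by measurable
  have int_F: "integrable P (\<lambda>\<omega>. rad n \<omega> * F (bid (Suc n) \<omega>))" if "n \<ge> 1" for n
    using that F_bounds by (intro int_rad) (auto simp: abs_le_iff intro: order_trans[of _ 0])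
  have int_win: "integrable P (\<lambda>\<omega>. rad n \<omega> * win n \<omega>)" if "n \<ge> 1" for n
    using that by (intro int_rad) (auto simp: win_def)
  have round: "best - expectation (\<lambda>\<omega>. util v F (bid (Suc n) \<omega>))
      \<le> 4 / F bopt * expectation (\<lambda>\<omega>. rad n \<omega> * win n \<omega>) + c n" if n: "n \<ge> 1" for n
  proof -
    define d where "d \<omega> = (if n < n0 then 2 else 2 * indicator (bad n) \<omega> :: real)" for \<omega>
    have int_d: "integrable P d"
      unfolding d_def by (cases "n < n0") (auto intro!: integrable_real_indicator simp: less_top[symmetric])
    have Ed: "expectation d = c n"
      unfolding d_def c_def by (cases "n < n0") (auto simp: prob_space)
    have "expectation (\<lambda>\<omega>. best - util v F (bid (Suc n) \<omega>))
        \<le> expectation (\<lambda>\<omega>. 4 / F bopt * (rad n \<omega> * F (bid (Suc n) \<omega>)) + d \<omega>)"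
    proof (rule integral_mono)
      show "integrable P (\<lambda>\<omega>. best - util v F (bid (Suc n) \<omega>))"
        using int_util[of "Suc n"] by simp
      show "integrable P (\<lambda>\<omega>. 4 / F bopt * (rad n \<omega> * F (bid (Suc n) \<omega>)) + d \<omega>)"
        using int_F[OF n] int_d by (intro Bochner_Integration.integrable_add integrable_mult_right)
      fix \<omega> assume \<omega>: "\<omega> \<in> space P"
      have r0: "0 \<le> 4 / F bopt * (rad n \<omega> * F (bid (Suc n) \<omega>))"
        using pos F_bounds \<gamma> by (intro mult_nonneg_nonneg radius_nonneg) auto
      show "best - util v F (bid (Suc n) \<omega>) \<le> 4 / F bopt * (rad n \<omega> * F (bid (Suc n) \<omega>)) + d \<omega>"
      proof (cases "n < n0 \<or> \<omega> \<in> bad n")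
        case True
        then have "d \<omega> = 2" by (auto simp: d_def)
        then show ?thesis using best_le[OF \<omega>, of "Suc n"] r0 by linarith
      next
        case False
        then have "d \<omega> = 0" by (auto simp: d_def)
        moreover have "best - util v F (bid (Suc n) \<omega>) \<le> 4 / F bopt * (rad n \<omega> * F (bid (Suc n) \<omega>))"
          unfolding best_def using False n0[of n] by (intro good_round \<omega> pos) auto
        ultimately show ?thesis by linarith
      qed
    qed
    also have "\<dots> = expectation (\<lambda>\<omega>. 4 / F bopt * (rad n \<omega> * F (bid (Suc n) \<omega>))) + expectation d"
      using int_F[OF n] int_d by (intro Bochner_Integration.integral_add integrable_mult_right)
    also have "expectation (\<lambda>\<omega>. 4 / F bopt * (rad n \<omega> * F (bid (Suc n) \<omega>)))
        = 4 / F bopt * expectation (\<lambda>\<omega>. rad n \<omega> * F (bid (Suc n) \<omega>))"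
      by (rule integral_mult_right_zero)
    finally show ?thesis
      using int_diff[of "Suc n"] Ed expectation_win[of n] by (simp add: win_def)
  qed
  have "regret P v F bid T
      \<le> 4 * sqrt 2 / F bopt * sqrt (\<gamma> * ln (real T)) * (sqrt (real T) + 1) + (2 + suminf c)"
    if T: "T \<ge> 1" for T
  proof -
    have "regret P v F bid T = (\<Sum>t=1..T. best - expectation (\<lambda>\<omega>. util v F (bid t \<omega>)))"
      by (simp add: regret_def best_def sum_subtractf)
    also have "\<dots> = (\<Sum>n\<in>{0..<T}. best - expectation (\<lambda>\<omega>. util v F (bid (Suc n) \<omega>)))"
      by (rule sum.reindex_bij_witness[of _ Suc "\<lambda>t. t - 1"]) auto
    also have "\<dots> = (best - expectation (\<lambda>\<omega>. util v F (bid 1 \<omega>)))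
        + (\<Sum>n\<in>{1..<T}. best - expectation (\<lambda>\<omega>. util v F (bid (Suc n) \<omega>)))"
      using T by (subst sum.atLeast_Suc_lessThan) auto
    also have "best - expectation (\<lambda>\<omega>. util v F (bid 1 \<omega>)) \<le> 2"
      unfolding int_diff[OF order_refl, symmetric]
      using best_le[of _ 1] int_util[of 1] by (intro integral_le_const) auto
    also have "(\<Sum>n\<in>{1..<T}. best - expectation (\<lambda>\<omega>. util v F (bid (Suc n) \<omega>)))
        \<le> (\<Sum>n\<in>{1..<T}. 4 / F bopt * expectation (\<lambda>\<omega>. rad n \<omega> * win n \<omega>) + c n)"
      by (intro sum_mono round) auto
    also have "\<dots> = 4 / F bopt * (\<Sum>n\<in>{1..<T}. expectation (\<lambda>\<omega>. rad n \<omega> * win n \<omega>)) + sum c {1..<T}"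
      by (simp add: sum.distrib sum_distrib_left)
    also have "sum c {1..<T} \<le> suminf c"
      using c_sum c0 by (intro sum_le_suminf) auto
    also have "(\<Sum>n\<in>{1..<T}. expectation (\<lambda>\<omega>. rad n \<omega> * win n \<omega>))
        = expectation (\<lambda>\<omega>. \<Sum>n\<in>{1..<T}. rad n \<omega> * win n \<omega>)"
      using int_win by (intro Bochner_Integration.integral_sum[symmetric]) auto
    also have "\<dots> \<le> sqrt (\<gamma> * ln (real T) / 2) * (2 * sqrt (real T))"
      using int_win sum_rad_wins[OF _ T] unfolding win_def
      by (intro integral_le_const AE_I2 Bochner_Integration.integrable_sum) auto
    finally have "regret P v F bid T \<le> 2 + (4 / F bopt * (sqrt (\<gamma> * ln (real T) / 2) * (2 * sqrt (real T))) + suminf c)"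
      using pos by (simp add: divide_right_mono)
    also have "4 / F bopt * (sqrt (\<gamma> * ln (real T) / 2) * (2 * sqrt (real T)))
        = 4 * sqrt 2 / F bopt * sqrt (\<gamma> * ln (real T)) * sqrt (real T)"
    proof -
      have "sqrt (\<gamma> * ln (real T) / 2) = sqrt (2 * (\<gamma> * ln (real T)) / 2\<^sup>2)"
        by (simp add: power2_eq_square)
      also have "\<dots> = sqrt 2 * sqrt (\<gamma> * ln (real T)) / 2"
        unfolding real_sqrt_divide real_sqrt_mult real_sqrt_abs by simp
      finally show ?thesis by simp
    qed
    also have "\<dots> \<le> 4 * sqrt 2 / F bopt * sqrt (\<gamma> * ln (real T)) * (sqrt (real T) + 1)"
      using pos \<gamma> T by (intro mult_left_mono) auto
    finally show ?thesis by simp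
  qed
  then show ?thesis by blast
qed

end

theorem theorem7:
  fixes P :: "'a measure" and V Mc :: "nat \<Rightarrow> 'a \<Rightarrow> real"
    and v \<gamma> :: real and F :: "real \<Rightarrow> real"
  assumes "prob_space P"
    and indep: "prob_space.indep_vars P (\<lambda>_. borel)
                  (\<lambda>i. case i of Inl t \<Rightarrow> V t | Inr t \<Rightarrow> Mc t) (UNIV :: (nat + nat) set)"
    and V_id: "\<And>t. distr P borel (V t) = distr P borel (V 0)"
    and M_id: "\<And>t. distr P borel (Mc t) = distr P borel (Mc 0)"
    and V_range: "\<And>t \<omega>. \<omega> \<in> space P \<Longrightarrow> V t \<omega> \<in> {0..1}"
    and M_range: "\<And>t \<omega>. \<omega> \<in> space P \<Longrightarrow> Mc t \<omega> \<in> {0..1}"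
    and v_mean: "prob_space.expectation P (V 0) = v"
    and F_cdf: "\<And>b. F b = measure P {\<omega> \<in> space P. Mc 0 \<omega> \<le> b}"
    and F_pos: "F (bstar v F) > 0"
    and \<gamma>: "\<gamma> > 1"
  shows "\<exists>C. \<forall>T::nat. T \<ge> 1 \<longrightarrow>
           regret P v F (\<lambda>t \<omega>. oucb_bid \<gamma> (\<lambda>s. V s \<omega>) (\<lambda>s. Mc s \<omega>) t) T
             \<le> 4 * sqrt 2 / F (bstar v F) * sqrt (\<gamma> * ln (real T)) * (sqrt (real T) + 1) + C"
proof -
  interpret prob_space P by fact
  interpret first_price_auction P V Mc v \<gamma> F
    by unfold_locales fact+
  show ?thesis using regret_bound[OF F_pos] by simp
qed

end
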